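(* Let $Q$ be a (finite) quiver with vertex set $Q_0$ and set of arrows $Q_1$, and fix a dimension vector $(n(x))_{x\in Q_0}$ of positive integers. Consider the corresponding representation $\pi$ of $G=\prod_{x\in Q_0}\mathrm{GL}(n(x))$ on the space $V=\bigoplus_{a\in Q_1}\mathrm{Mat}(n(ha),n(ta))$. Let $k:=|Q_0|$, $n:=\sum_{x\in Q_0}n(x)$ and $P:=\prod_{x\in Q_0}n(x)$. Then: (1) The weight matrix of $\pi$ is totally unimodular. (2) $\gamma(\pi)\ge n^{-3/2}$. (3) $N(\pi)\le\sqrt2$ (with equality unless $Q$ has only self-loops and $n(x)=1$ for all $x$). (4) The restriction $\pi_0$ of $\pi$ to the subgroup $\prod_{x\in Q_0}\mathrm{SL}(n(x))$ has weight margin bounded below as $$\gamma(\pi_0)\ \ge\ P^{-k}(n+1)^{-k}n^{-3/2}.$$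
   Context: A quiver is a directed graph with loops and parallel edges allowed; an arrow $a\in Q_1$ has head $ha$ and tail $ta$ in $Q_0$. The action is $(\pi(g)X)_a=g_{ha}X_ag_{ta}^{-1}$ for $g=(g_x)\in G$, $X=(X_a)\in V$. $\mathrm{Mat}(p,q)$ is the space of complex $p\times q$ matrices. Weights: $G$ is embedded block-diagonally in $\mathrm{GL}(n)$. The set of weights $\Omega(\pi)\subset\mathbb Z^n$ consists of those $\omega$ for which there is a nonzero $w\in V$ with $\pi(\operatorname{diag}(t))w=\prod_i t_i^{\omega_i}w$ for all invertible diagonal matrices $\operatorname{diag}(t)$. For the restriction $\pi_0$ to $\prod_x\mathrm{SL}(n(x))$, each weight $(\omega_x)_x$, $\omega_x\in\mathbb Z^{n(x)}$, gives the weight $(\omega_x-\frac{s_x}{n(x)}(1,\dots,1))_x$, where $s_x$ is the sum of the entries of $\omega_x$. The weight matrix has the distinct weights as its rows (each weight appearing once). An integer matrix is totally unimodular if all its subdeterminants are $0$, $1$ or $-1$. Weight norm: $N(\pi)=\max_{\omega\in\Omega(\pi)}\|\omega\|_2$. Weight margin: $\gamma(\pi)=\min\{d(0,\operatorname{conv}\Gamma):\emptyset\neq\Gamma\subseteq\Omega(\pi),\ 0\notin\operatorname{conv}\Gamma\}$ with Euclidean distance ($+\infty$ if there is no such $\Gamma$); $\gamma(\pi_0)$ is defined in the same way from the weights of $\pi_0$.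
   Formalization: In (3), "n(x)=1 for all x" is taken over vertices carrying arrows, and equality is proved exactly outside that case; over all x the clause fails (a loop at a vertex with n(x)=1 plus an isolated vertex with n(x)=2 has N=0). N is set to 0 if V=0. *)

theory Defs
  imports
    "HOL-Analysis.Finite_Function_Topology"
    "HOL-Analysis.Convex"
    "HOL-Analysis.L2_Norm"
    "HOL-Algebra.Product_Groups"
    "HOL-Library.Extended_Real"
    "Jordan_Normal_Form.Determinant"
    "Graph_Theory.Digraph"
begin

text \<open>
  A finite quiver is a \<open>fin_digraph\<close>: \<open>verts Q\<close> and \<open>arcs Q\<close> are finite, loops and parallel arcs
  are allowed, and the arc \<open>a\<close> goes from \<open>tail Q a\<close> to \<open>head Q a\<close>.  A dimension vector is a
  function \<open>d\<close> on vertices; only its values on \<open>verts Q\<close> matter.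
\<close>

definition GL :: "nat \<Rightarrow> complex mat monoid" where
  "GL m = units_of (ring_mat TYPE(complex) m ())"

definition quiver_group :: "('v, 'a) pre_digraph \<Rightarrow> ('v \<Rightarrow> nat) \<Rightarrow> ('v \<Rightarrow> complex mat) monoid" where
  "quiver_group Q d = product_group (verts Q) (\<lambda>x. GL (d x))"

definition quiver_space :: "('v, 'a) pre_digraph \<Rightarrow> ('v \<Rightarrow> nat) \<Rightarrow> ('a \<Rightarrow> complex mat) set" where
  "quiver_space Q d = (\<Pi>\<^sub>E a\<in>arcs Q. carrier_mat (d (head Q a)) (d (tail Q a)))"

definition quiver_zero :: "('v, 'a) pre_digraph \<Rightarrow> ('v \<Rightarrow> nat) \<Rightarrow> 'a \<Rightarrow> complex mat" where
  "quiver_zero Q d = (\<lambda>a\<in>arcs Q. 0\<^sub>m (d (head Q a)) (d (tail Q a)))"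

definition quiver_smult :: "('v, 'a) pre_digraph \<Rightarrow> complex \<Rightarrow> ('a \<Rightarrow> complex mat) \<Rightarrow> 'a \<Rightarrow> complex mat" where
  "quiver_smult Q c X = (\<lambda>a\<in>arcs Q. c \<cdot>\<^sub>m X a)"

definition quiver_rep ::
  "('v, 'a) pre_digraph \<Rightarrow> ('v \<Rightarrow> nat) \<Rightarrow> ('v \<Rightarrow> complex mat) \<Rightarrow> ('a \<Rightarrow> complex mat) \<Rightarrow> 'a \<Rightarrow> complex mat" where
  "quiver_rep Q d g X =
     (\<lambda>a\<in>arcs Q. g (head Q a) * X a * (inv\<^bsub>GL (d (tail Q a))\<^esub> g (tail Q a)))"

text \<open>
  The \<open>n\<close> coordinates of the diagonal torus of \<open>GL(n)\<close> are labelled by the pairs \<open>(x, i)\<close> with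
  \<open>i < d x\<close> instead of by \<open>1, \<dots>, n\<close>, so no ordering of the vertices has to be chosen.
  Vectors in \<open>\<int>\<^sup>n\<close> and \<open>\<real>\<^sup>n\<close> are finitely supported functions with support in this set.
\<close>

definition coords :: "('v, 'a) pre_digraph \<Rightarrow> ('v \<Rightarrow> nat) \<Rightarrow> ('v \<times> nat) set" where
  "coords Q d = (SIGMA x:verts Q. {..<d x})"

definition torus_elem ::
  "('v, 'a) pre_digraph \<Rightarrow> ('v \<Rightarrow> nat) \<Rightarrow> ('v \<times> nat \<Rightarrow> complex) \<Rightarrow> 'v \<Rightarrow> complex mat" where
  "torus_elem Q d t = (\<lambda>x\<in>verts Q. mat_diag (d x) (\<lambda>i. t (x, i)))"

lemma torus_elem_in_group:
  assumes "\<And>p. p \<in> coords Q d \<Longrightarrow> t p \<noteq> 0"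
  shows "torus_elem Q d t \<in> carrier (quiver_group Q d)"
proof -
  have "mat_diag (d x) (\<lambda>i. t (x, i)) \<in> carrier (GL (d x))" if x: "x \<in> verts Q" for x
  proof -
    have nz: "t (x, i) \<noteq> 0" if "i < d x" for i
      using assms[of "(x, i)"] x that by (simp add: coords_def)
    have "mat_diag (d x) (\<lambda>i. inverse (t (x, i)) * t (x, i)) = 1\<^sub>m (d x)"
      "mat_diag (d x) (\<lambda>i. t (x, i) * inverse (t (x, i))) = 1\<^sub>m (d x)"
      using nz by (auto intro!: eq_matI simp: mat_diag_def)
    then show ?thesis
      unfolding GL_def units_of_def Units_def
      by (auto simp: ring_mat_def mat_diag_dim
          intro!: bexI[of _ "mat_diag (d x) (\<lambda>i. inverse (t (x, i)))"])
  qed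
  then show ?thesis
    by (simp add: quiver_group_def torus_elem_def)
qed

definition weights :: "('v, 'a) pre_digraph \<Rightarrow> ('v \<Rightarrow> nat) \<Rightarrow> ('v \<times> nat \<Rightarrow>\<^sub>0 int) set" where
  "weights Q d =
     {\<omega>. Poly_Mapping.keys \<omega> \<subseteq> coords Q d \<and>
         (\<exists>w\<in>quiver_space Q d. w \<noteq> quiver_zero Q d \<and>
            (\<forall>t. (\<forall>p\<in>coords Q d. t p \<noteq> 0) \<longrightarrow>
               quiver_rep Q d (torus_elem Q d t) w =
               quiver_smult Q (\<Prod>p\<in>coords Q d. t p powi Poly_Mapping.lookup \<omega> p) w))}"

definition real_weights :: "('v, 'a) pre_digraph \<Rightarrow> ('v \<Rightarrow> nat) \<Rightarrow> ('v \<times> nat \<Rightarrow>\<^sub>0 real) set" where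
  "real_weights Q d = Poly_Mapping.map real_of_int ` weights Q d"

text \<open>Weights of the restriction of the representation to the product of the \<open>SL(d x)\<close>.\<close>

definition SL_weights :: "('v, 'a) pre_digraph \<Rightarrow> ('v \<Rightarrow> nat) \<Rightarrow> ('v \<times> nat \<Rightarrow>\<^sub>0 real) set" where
  "SL_weights Q d =
     {v. Poly_Mapping.keys v \<subseteq> coords Q d \<and>
         (\<exists>\<omega>\<in>weights Q d. \<forall>x\<in>verts Q. \<forall>i<d x.
            Poly_Mapping.lookup v (x, i) =
              real_of_int (Poly_Mapping.lookup \<omega> (x, i))
              - real_of_int (\<Sum>j<d x. Poly_Mapping.lookup \<omega> (x, j)) / real (d x))}"

text \<open>
  The library's \<open>norm\<close> and \<open>dist\<close> on finitely supported functions are those of \<open>\<ell>\<^sup>1\<close>, so the Euclidean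
  norm is introduced separately.
\<close>

definition norm2 :: "('i \<Rightarrow>\<^sub>0 real) \<Rightarrow> real" where
  "norm2 v = L2_set (Poly_Mapping.lookup v) (Poly_Mapping.keys v)"

text \<open>The weight norm of a representation without weights (zero space) is set to \<open>0\<close>.\<close>

definition weight_norm :: "('i \<Rightarrow>\<^sub>0 real) set \<Rightarrow> real" where
  "weight_norm \<Omega> = (if \<Omega> = {} then 0 else Max (norm2 ` \<Omega>))"

definition weight_margin :: "('i \<Rightarrow>\<^sub>0 real) set \<Rightarrow> ereal" where
  "weight_margin \<Omega> =
     (INF \<Gamma>\<in>{\<Gamma>. \<Gamma> \<noteq> {} \<and> \<Gamma> \<subseteq> \<Omega> \<and> 0 \<notin> convex hull \<Gamma>}. ereal (INF v\<in>convex hull \<Gamma>. norm2 v))"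

text \<open>
  Here a matrix is a family of entries with rows indexed by \<open>R\<close> and columns by \<open>C\<close>.  The injections
  \<open>r\<close> and \<open>c\<close> select a square submatrix; the order in which they list it affects only the sign of
  the determinant.
\<close>

definition totally_unimodular :: "'r set \<Rightarrow> 'c set \<Rightarrow> ('r \<Rightarrow> 'c \<Rightarrow> int) \<Rightarrow> bool" where
  "totally_unimodular R C M \<longleftrightarrow>
     (\<forall>m r c. inj_on r {..<m} \<and> r ` {..<m} \<subseteq> R \<and> inj_on c {..<m} \<and> c ` {..<m} \<subseteq> C \<longrightarrow>
        Determinant.det (Matrix.mat m m (\<lambda>(i, j). M (r i) (c j))) \<in> {-1, 0, 1})"

end

theory Submission
  imports Defs "HOL-Analysis.Convex_Euclidean_Space"
begin

text \<open>
  Since the diagonal torus scales each matrix entry separately, the weights are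
  exactly the vectors \<open>e\<^sub>p - e\<^sub>q\<close>, where \<open>p\<close> is a coordinate at the head and \<open>q\<close> a coordinate at the tail
  of an arrow (\<open>weights_eq_roots\<close>).  A set of weights is therefore a directed graph on the \<open>n\<close>
  coordinates.  Its matrix is a signed incidence matrix, which is totally unimodular by expanding
  along a row with at most one nonzero entry (\<open>det_signed_incidence\<close>), and the norm of a weight is
  \<open>0\<close> or \<open>\<surd>2\<close>.

  For the margins, let \<open>\<Gamma>\<close> be a set of weights whose convex hull avoids \<open>0\<close>.  A linear functional
  \<open>\<phi>\<close> with value at least \<open>1\<close> on \<open>\<Gamma>\<close> exists by separation, and by Cauchy--Schwarz every such \<open>\<phi>\<close>
  bounds the distance from \<open>0\<close> to the hull below by \<open>1 / \<parallel>\<phi>\<parallel>\<close> (\<open>weight_margin_ge\<close>).  So the task is to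
  find a \<^emph>\<open>short\<close> \<open>\<phi>\<close>.  On the graph, \<open>\<phi>\<close> is a potential that drops by at least \<open>1\<close> along each edge.

  For \<open>GL\<close> there is nothing else to respect, so \<open>\<phi>\<close> may be replaced by its rank function, with values
  between \<open>0\<close> and \<open>n\<close>; hence \<open>\<parallel>\<phi>\<parallel> \<le> n\<^bsup>3/2\<^esup>\<close> (\<open>rank_potential\<close>).

  For \<open>SL\<close> the weights are projected to the vectors with zero sum at each vertex, so \<open>\<phi>\<close> is taken to have
  zero sum at each vertex as well.  These potentials form a polyhedron, and a rigid point of it, which
  plays the part of a vertex, is short (\<open>bounded_balanced_potential\<close>).  Call two coordinates linked
  when their values differ by \<open>-1\<close>, \<open>0\<close> or \<open>1\<close>.  If the classes generated by the links could be
  shifted against each other without changing the vertex sums, such a shift could be continued until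
  a new link appears; so in a potential with the most pairs in a common class only the zero shift remains.
  Within a class the values then differ by integers below \<open>n\<close>, and the positions of the classes solve an
  integer linear system with one equation for each vertex and trivial kernel.  Cramer's rule, with
  denominator at least \<open>1\<close> and numerator at most the product of the row sums \<open>n(x) n\<close>, bounds the
  positions by \<open>P n\<^sup>k\<close>.
\<close>

section \<open>Determinants\<close>

lemma mat_delete_mat:
  assumes "i < Suc m" "j < Suc m"
  shows "mat_delete (Matrix.mat (Suc m) (Suc m) (\<lambda>(i, j). f i j)) i j =
    Matrix.mat m m (\<lambda>(i', j'). f (if i' < i then i' else Suc i') (if j' < j then j' else Suc j'))"
  using assms by (intro eq_matI) (auto simp: mat_delete_def)

text \<open>
  If every row has both its \<open>+1\<close> and its \<open>-1\<close> inside the chosen columns, the columns sum to zero and the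
  determinant vanishes.  Otherwise some row has at most one nonzero entry, and Laplace expansion
  along it leaves a smaller matrix of the same kind.  Deleting a column can make two rows coincide, so
  the induction is over arbitrary families of rows.
\<close>

lemma det_signed_incidence:
  fixes p q c :: "nat \<Rightarrow> 'c"
  assumes "inj_on c {..<m}"
  shows "Determinant.det (Matrix.mat m m (\<lambda>(i, j). of_bool (c j = p i) - of_bool (c j = q i)))
    \<in> {-1, 0, 1 :: int}"
  using assms
proof (induction m arbitrary: p q c)
  case 0
  then show ?case by (simp add: det_dim_zero)
next
  case (Suc m)
  define f where "f = (\<lambda>i j. of_bool (c j = p i) - of_bool (c j = q i) :: int)"
  define A where "A = Matrix.mat (Suc m) (Suc m) (\<lambda>(i, j). f i j)"
  have A: "A \<in> carrier_mat (Suc m) (Suc m)" by (simp add: A_def)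
  have at_most_one: "\<exists>j0<Suc m. \<forall>j<Suc m. j \<noteq> j0 \<longrightarrow> c j \<noteq> x" for x
  proof (cases "x \<in> c ` {..<Suc m}")
    case True
    then obtain j0 where "j0 < Suc m" "x = c j0" by auto
    then show ?thesis using Suc.prems by (metis inj_on_def lessThan_iff)
  next
    case False
    then show ?thesis by (auto intro!: exI[of _ 0])
  qed
  show ?case
  proof (cases "\<forall>i<Suc m. p i \<in> c ` {..<Suc m} \<and> q i \<in> c ` {..<Suc m}")
    case True
    let ?one = "Matrix.vec (Suc m) (\<lambda>_. 1 :: int)"
    have count: "(\<Sum>j<Suc m. of_bool (c j = x)) = (1 :: int)" if "x \<in> c ` {..<Suc m}" for x
    proof -
      obtain j0 where j0: "j0 < Suc m" "x = c j0" using \<open>x \<in> _\<close> by auto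
      have "(\<Sum>j<Suc m. of_bool (c j = x)) = (\<Sum>j<Suc m. if j = j0 then 1 else (0 :: int))"
        using j0 Suc.prems by (intro sum.cong) (auto simp: inj_on_def)
      then show ?thesis using j0 by simp
    qed
    have "A *\<^sub>v ?one = 0\<^sub>v (Suc m)"
    proof (rule eq_vecI)
      fix i assume "i < dim_vec (0\<^sub>v (Suc m) :: int Matrix.vec)"
      then have i: "i < Suc m" by simp
      have "(A *\<^sub>v ?one) $ i = (\<Sum>j<Suc m. f i j)"
        using i by (simp add: A_def scalar_prod_def atLeast0LessThan del: sum.lessThan_Suc)
      also have "\<dots> = 0"
      proof -
        have "p i \<in> c ` {..<Suc m}" "q i \<in> c ` {..<Suc m}" using True i by auto
        then show ?thesis by (simp only: f_def sum_subtractf count diff_self)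
      qed
      finally show "(A *\<^sub>v ?one) $ i = 0\<^sub>v (Suc m) $ i" using i by simp
    qed (simp add: A_def)
    moreover have "?one \<noteq> 0\<^sub>v (Suc m)"
      by (metis index_vec index_zero_vec(1) zero_less_Suc zero_neq_one)
    ultimately have "Determinant.det A = 0"
      using det_0_iff_vec_prod_zero[OF A] by (metis vec_carrier)
    then show ?thesis by (simp add: A_def f_def)
  next
    case False
    then obtain i where i: "i < Suc m" and out: "p i \<notin> c ` {..<Suc m} \<or> q i \<notin> c ` {..<Suc m}"
      by blast
    have "\<exists>x. \<forall>j<Suc m. c j \<noteq> x \<longrightarrow> f i j = 0"
    proof (cases "p i \<in> c ` {..<Suc m}")
      case True
      with out have "\<forall>j<Suc m. c j \<noteq> q i" by (metis imageI lessThan_iff)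
      then show ?thesis by (intro exI[of _ "p i"]) (simp add: f_def)
    next
      case False
      then have "\<forall>j<Suc m. c j \<noteq> p i" by (metis imageI lessThan_iff)
      then show ?thesis by (intro exI[of _ "q i"]) (simp add: f_def)
    qed
    then obtain j0 where j0: "j0 < Suc m" and zero: "\<And>j. j < Suc m \<Longrightarrow> j \<noteq> j0 \<Longrightarrow> f i j = 0"
      using at_most_one by metis
    let ?s = "\<lambda>k l. if l < k then l else Suc l"
    have "inj_on (c \<circ> ?s j0) {..<m}"
    proof (rule comp_inj_on)
      show "inj_on (?s j0) {..<m}" by (auto simp: inj_on_def split: if_splits)
      show "inj_on c (?s j0 ` {..<m})"
        by (rule inj_on_subset[OF Suc.prems]) auto
    qed
    from Suc.IH[OF this, of "p \<circ> ?s i" "q \<circ> ?s i"]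
    have minor: "Determinant.det (mat_delete A i j0) \<in> {-1, 0, 1}"
      using i j0 by (simp add: A_def mat_delete_mat f_def)
    have "Determinant.det A = (\<Sum>j<Suc m. A $$ (i, j) * cofactor A i j)"
      by (rule laplace_expansion_row[OF A i])
    also have "\<dots> = (\<Sum>j<Suc m. if j = j0 then f i j0 * cofactor A i j0 else 0)"
      using i j0 zero by (intro sum.cong) (auto simp: A_def)
    also have "\<dots> = f i j0 * cofactor A i j0" using j0 by simp
    finally have "Determinant.det A = f i j0 * ((-1) ^ (i + j0) * Determinant.det (mat_delete A i j0))"
      by (simp add: cofactor_def)
    moreover have "f i j0 \<in> {-1, 0, 1}" by (auto simp: f_def)
    moreover have "(-1 :: int) ^ (i + j0) \<in> {-1, 1}" by (cases "even (i + j0)") auto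
    ultimately have "Determinant.det A \<in> {-1, 0, 1}" using minor by auto
    then show ?thesis by (simp add: A_def f_def)
  qed
qed

text \<open>
  The product of the row sums expands into a sum over all maps from rows to columns; the Leibniz
  formula uses only those maps that are permutations.
\<close>

lemma abs_det_le_prod_row_sums:
  fixes A :: "real mat"
  assumes A: "A \<in> carrier_mat n n"
  shows "\<bar>Determinant.det A\<bar> \<le> (\<Prod>i<n. \<Sum>j<n. \<bar>A $$ (i, j)\<bar>)"
proof -
  let ?h = "\<lambda>g. \<Prod>i<n. \<bar>A $$ (i, g i)\<bar>"
  let ?res = "\<lambda>p. restrict p {..<n}"
  have "Determinant.det A = (\<Sum>p | p permutes {..<n}. signof p * (\<Prod>i<n. A $$ (i, p i)))"
    using det_def'[OF A] by (simp add: atLeast0LessThan)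
  then have "\<bar>Determinant.det A\<bar> \<le> (\<Sum>p | p permutes {..<n}. \<bar>signof p * (\<Prod>i<n. A $$ (i, p i))\<bar>)"
    by (simp add: sum_abs)
  also have "\<dots> = (\<Sum>p | p permutes {..<n}. ?h (?res p))"
    by (intro sum.cong) (auto simp: abs_mult abs_prod sign_def)
  also have "\<dots> = sum ?h (?res ` {p. p permutes {..<n}})"
  proof (rule sum.reindex_cong[symmetric])
    show "inj_on ?res {p. p permutes {..<n}}"
    proof (rule inj_onI, clarify, rule ext)
      fix p q i assume "p permutes {..<n}" "q permutes {..<n}" "?res p = ?res q"
      then show "p i = q i"
        by (cases "i \<in> {..<n}") (metis restrict_apply', metis permutes_not_in)
    qed
  qed auto
  also have "\<dots> \<le> sum ?h (PiE {..<n} (\<lambda>_. {..<n}))"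
  proof (rule sum_mono2)
    show "?res ` {p. p permutes {..<n}} \<subseteq> PiE {..<n} (\<lambda>_. {..<n})"
      using permutes_in_image by fastforce
  qed (simp_all add: prod_nonneg finite_PiE)
  also have "\<dots> = (\<Prod>i<n. \<Sum>j<n. \<bar>A $$ (i, j)\<bar>)"
    by (rule prod_sum_PiE[symmetric]) auto
  finally show ?thesis .
qed

text \<open>
  Row rank equals column rank, in the form needed to cut a square system out of one with trivial
  kernel.  Given \<open>c\<close> good rows for the first \<open>c\<close> columns, expand the determinant obtained by adding
  one more row \<open>x\<close> along that row.  The cofactors are independent of \<open>x\<close> and the last of them is
  nonzero, so if every choice of \<open>x\<close> gave \<open>0\<close> they would form a nonzero kernel vector.
\<close>

lemma exists_nonsingular_rows:
  fixes A :: "'x \<Rightarrow> nat \<Rightarrow> real"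
  assumes "\<And>z. (\<And>x. x \<in> X \<Longrightarrow> (\<Sum>j<c. A x j * z j) = 0) \<Longrightarrow> \<forall>j<c. z j = 0"
  obtains r where "r ` {..<c} \<subseteq> X" "Determinant.det (Matrix.mat c c (\<lambda>(i, j). A (r i) j)) \<noteq> 0"
proof -
  have "\<exists>r. r ` {..<c} \<subseteq> X \<and> Determinant.det (Matrix.mat c c (\<lambda>(i, j). A (r i) j)) \<noteq> 0"
    using assms
  proof (induction c)
    case 0
    then show ?case by (simp add: det_dim_zero)
  next
    case (Suc c)
    have "\<forall>j<c. z j = 0" if "\<And>x. x \<in> X \<Longrightarrow> (\<Sum>j<c. A x j * z j) = 0" for z
      using Suc.prems[of "z(c := 0)"] that by (simp add: less_Suc_eq)
    from Suc.IH[OF this] obtain r where r: "r ` {..<c} \<subseteq> X"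
      and nz: "Determinant.det (Matrix.mat c c (\<lambda>(i, j). A (r i) j)) \<noteq> 0" by auto
    define z where "z j = (-1) ^ (c + j) *
      Determinant.det (Matrix.mat c c (\<lambda>(i, l). A (r i) (if l < j then l else Suc l)))" for j
    have expand: "Determinant.det (Matrix.mat (Suc c) (Suc c) (\<lambda>(i, j). A ((r(c := x)) i) j))
        = (\<Sum>j<Suc c. A x j * z j)" for x
    proof -
      define M where "M = Matrix.mat (Suc c) (Suc c) (\<lambda>(i, j). A ((r(c := x)) i) j)"
      have M: "M \<in> carrier_mat (Suc c) (Suc c)" by (simp add: M_def)
      have "cofactor M c j = z j" if "j < Suc c" for j
      proof -
        have "mat_delete M c j = Matrix.mat c c (\<lambda>(i, l). A (r i) (if l < j then l else Suc l))"
          unfolding M_def using that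
          by (subst mat_delete_mat) (auto intro!: eq_matI)
        then show ?thesis by (simp add: cofactor_def z_def)
      qed
      then have "Determinant.det M = (\<Sum>j<Suc c. A x j * z j)"
        unfolding laplace_expansion_row[OF M lessI]
        by (intro sum.cong) (auto simp: M_def)
      then show ?thesis by (simp add: M_def)
    qed
    have "Matrix.mat c c (\<lambda>(i, l). A (r i) (if l < c then l else Suc l)) =
        Matrix.mat c c (\<lambda>(i, l). A (r i) l)"
      by (intro eq_matI) auto
    then have "z c \<noteq> 0" using nz by (simp add: z_def)
    then obtain x where "x \<in> X" "(\<Sum>j<Suc c. A x j * z j) \<noteq> 0"
      using Suc.prems[of z] by blast
    with r expand[of x] show ?case
      by (intro exI[of _ "r(c := x)"]) (auto simp: less_Suc_eq image_subset_iff)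
  qed
  then show ?thesis using that by blast
qed

section \<open>Short potentials with prescribed vertex sums\<close>

text \<open>
  For a potential \<open>\<phi>\<close> that drops by at least \<open>1\<close> along every edge, the links contain all edges on which
  this constraint is tight.  Linking also the other pairs at distance \<open>0\<close> or \<open>1\<close> makes every nontrivial
  shift create a link, even one that leads to no tight constraint.
\<close>

definition unit_links :: "'i set \<Rightarrow> ('i \<Rightarrow> real) \<Rightarrow> ('i \<times> 'i) set" where
  "unit_links I \<phi> = {(i, j) \<in> I \<times> I. \<phi> i - \<phi> j \<in> {-1, 0, 1}}"

lemma equiv_unit_links: "equiv I ((unit_links I \<phi>)\<^sup>+)"
proof (rule equivI)
  show "(unit_links I \<phi>)\<^sup>+ \<subseteq> I \<times> I"
    by (rule trancl_subset_Sigma) (auto simp: unit_links_def)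
  show "refl_on I ((unit_links I \<phi>)\<^sup>+)"
    by (auto simp: refl_on_def unit_links_def)
  have "sym (unit_links I \<phi>)"
    by (rule symI) (auto simp: unit_links_def)
  then show "sym ((unit_links I \<phi>)\<^sup>+)" by (rule sym_trancl)
qed simp

text \<open>
  A chain of links moves in unit steps, so it cannot jump over an integer offset.
\<close>

lemma linked_values_fill_interval:
  assumes "(i, j) \<in> (unit_links I \<phi>)\<^sup>+"
  shows "\<exists>m :: int. \<phi> j = \<phi> i + of_int m \<and>
    (\<forall>l :: int. 0 \<le> l \<and> l \<le> m \<or> m \<le> l \<and> l \<le> 0 \<longrightarrow> \<phi> i + of_int l \<in> \<phi> ` I)"
  using assms
proof (induction rule: trancl_induct)
  case (base j)
  then have ij: "i \<in> I" "j \<in> I" and "\<phi> i - \<phi> j \<in> {-1, 0, 1}"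
    by (auto simp: unit_links_def)
  then obtain m :: int where m: "m \<in> {-1, 0, 1}" "\<phi> j = \<phi> i + of_int m"
  proof -
    have "\<phi> j = \<phi> i + of_int 1 \<or> \<phi> j = \<phi> i + of_int 0 \<or> \<phi> j = \<phi> i + of_int (-1)"
      using \<open>\<phi> i - \<phi> j \<in> {-1, 0, 1}\<close> by auto
    then show ?thesis using that by blast
  qed
  have "\<phi> i + of_int l \<in> \<phi> ` I" if "0 \<le> l \<and> l \<le> m \<or> m \<le> l \<and> l \<le> 0" for l :: int
  proof -
    have "l = 0 \<or> l = m" using that m(1) by auto
    then show ?thesis using ij m(2) by (metis add.right_neutral image_eqI of_int_0)
  qed
  then show ?case using m(2) by blast
next
  case (step j k)
  then obtain m :: int where m: "\<phi> j = \<phi> i + of_int m"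
    and fill: "\<And>l. 0 \<le> l \<and> l \<le> m \<or> m \<le> l \<and> l \<le> 0 \<Longrightarrow> \<phi> i + of_int l \<in> \<phi> ` I"
    by blast
  have k: "k \<in> I" and "\<phi> j - \<phi> k \<in> {-1, 0, 1}"
    using step.hyps(2) by (auto simp: unit_links_def)
  then have "\<phi> k = \<phi> i + of_int (m + 1) \<or> \<phi> k = \<phi> i + of_int m \<or> \<phi> k = \<phi> i + of_int (m - 1)"
    using m by auto
  then obtain m' where m': "m' \<in> {m - 1, m, m + 1}" "\<phi> k = \<phi> i + of_int m'" by blast
  have "\<phi> i + of_int l \<in> \<phi> ` I" if "0 \<le> l \<and> l \<le> m' \<or> m' \<le> l \<and> l \<le> 0" for l :: int
  proof (cases "l = m'")
    case True
    then show ?thesis using k m'(2) by (metis image_eqI)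
  next
    case False
    then show ?thesis using that m'(1) by (intro fill) auto
  qed
  then show ?case using m'(2) by blast
qed

text \<open>
  The \<open>\<bar>m\<bar> + 1\<close> distinct values between the two ends of a chain are all attained on \<open>I\<close>.
\<close>

lemma linked_differences_bounded:
  assumes "finite I" "(i, j) \<in> (unit_links I \<phi>)\<^sup>+"
  shows "\<phi> j - \<phi> i \<in> \<int>" "\<bar>\<phi> j - \<phi> i\<bar> \<le> real (card I) - 1"
proof -
  obtain m :: int where m: "\<phi> j = \<phi> i + of_int m"
    and fill: "\<And>l. 0 \<le> l \<and> l \<le> m \<or> m \<le> l \<and> l \<le> 0 \<Longrightarrow> \<phi> i + of_int l \<in> \<phi> ` I"
    using linked_values_fill_interval[OF assms(2)] by blast
  show "\<phi> j - \<phi> i \<in> \<int>" using m by simp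
  let ?L = "{min 0 m..max 0 m}"
  have "(\<lambda>l. \<phi> i + of_int l) ` ?L \<subseteq> \<phi> ` I"
    using fill by (auto simp: min_def max_def split: if_splits)
  then have "card ((\<lambda>l. \<phi> i + of_int l) ` ?L) \<le> card I"
    using assms(1) by (meson card_image_le card_mono finite_imageI le_trans)
  moreover have "card ((\<lambda>l. \<phi> i + of_int l) ` ?L) = card ?L"
    by (rule card_image) (auto simp: inj_on_def)
  ultimately have "\<bar>m\<bar> + 1 \<le> int (card I)" by (simp add: min_def max_def split: if_splits)
  then have "real_of_int (\<bar>m\<bar> + 1) \<le> real_of_int (int (card I))" by (simp only: of_int_le_iff)
  then show "\<bar>\<phi> j - \<phi> i\<bar> \<le> real (card I) - 1" using m by simp
qed

text \<open>
  Moving \<open>\<phi>\<close> along \<open>z\<close> changes the differences of exactly the pairs on which \<open>z\<close> is not constant, and none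
  of these is linked.  Stop at the parameter of least absolute value at which such a pair
  becomes linked.  An edge constraint cannot have been violated before: on its way below \<open>1\<close> the
  difference would have passed through the value \<open>1\<close>, which is a link.
\<close>

lemma slide_until_new_link:
  fixes \<phi> z :: "'i \<Rightarrow> real"
  assumes "finite I" "E \<subseteq> I \<times> I"
    and feas: "\<And>i j. (i, j) \<in> E \<Longrightarrow> \<phi> i - \<phi> j \<ge> 1"
    and const: "\<And>i j. (i, j) \<in> unit_links I \<phi> \<Longrightarrow> z i = z j"
    and "i0 \<in> I" "j0 \<in> I" "z i0 \<noteq> z j0"
  obtains s where "\<forall>(i, j) \<in> E. (\<phi> i + s * z i) - (\<phi> j + s * z j) \<ge> 1"
    and "unit_links I \<phi> \<subseteq> unit_links I (\<lambda>i. \<phi> i + s * z i)"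
    and "\<exists>(i, j) \<in> unit_links I (\<lambda>i. \<phi> i + s * z i). z i \<noteq> z j"
proof -
  define S where "S = (\<lambda>(i, j, e). (e - (\<phi> i - \<phi> j)) / (z i - z j)) `
    {(i, j, e) \<in> I \<times> I \<times> {-1, 0, 1}. z i \<noteq> z j}"
  have "finite S"
    unfolding S_def
  proof (rule finite_imageI, rule finite_subset)
    show "finite (I \<times> I \<times> {-1, 0, 1 :: real})" using assms(1) by simp
  qed auto
  have "S \<noteq> {}" using assms(5-7) by (auto simp: S_def)
  then obtain s where s: "s \<in> S" and least: "\<And>t. t \<in> S \<Longrightarrow> \<bar>s\<bar> \<le> \<bar>t\<bar>"
    using ex_is_arg_min_if_finite[OF \<open>finite S\<close>, of abs]
    by (auto simp: is_arg_min_def not_less)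
  show thesis
  proof (rule that)
    have "(\<phi> i + s * z i) - (\<phi> j + s * z j) \<ge> 1"
      if ij: "(i, j) \<in> E" for i j
    proof (cases "z i = z j")
      case True
      then show ?thesis using feas[OF ij] by simp
    next
      case False
      have I: "i \<in> I" "j \<in> I" using ij assms(2) by auto
      have "\<phi> i - \<phi> j \<noteq> 1" using False const[of i j] I by (auto simp: unit_links_def)
      with feas[OF ij] have gt: "\<phi> i - \<phi> j > 1" by simp
      show ?thesis
      proof (rule ccontr)
        define u where "u = z i - z j"
        assume "\<not> ?thesis"
        then have neg: "\<phi> i - \<phi> j - 1 < - (s * u)" by (simp add: u_def algebra_simps)
        \<comment> \<open>the parameter at which the difference along the edge passes through \<open>1\<close>\<close>
        define t where "t = (1 - (\<phi> i - \<phi> j)) / u"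
        have "u \<noteq> 0" using False by (simp add: u_def)
        have "t \<in> S" unfolding S_def t_def u_def using I False by force
        have "\<bar>t\<bar> * \<bar>u\<bar> = \<phi> i - \<phi> j - 1"
          using \<open>u \<noteq> 0\<close> gt by (simp add: t_def abs_divide)
        also have "\<dots> < \<bar>s\<bar> * \<bar>u\<bar>" using neg by (simp flip: abs_mult)
        finally have "\<bar>t\<bar> < \<bar>s\<bar>" by (simp add: mult_less_cancel_right)
        with least[OF \<open>t \<in> S\<close>] show False by simp
      qed
    qed
    then show "\<forall>(i, j) \<in> E. (\<phi> i + s * z i) - (\<phi> j + s * z j) \<ge> 1" by blast
  next
    show "unit_links I \<phi> \<subseteq> unit_links I (\<lambda>i. \<phi> i + s * z i)"
    proof
      fix p assume "p \<in> unit_links I \<phi>"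
      moreover obtain i j where "p = (i, j)" by fastforce
      ultimately show "p \<in> unit_links I (\<lambda>i. \<phi> i + s * z i)"
        using const[of i j] by (auto simp: unit_links_def)
    qed
  next
    obtain i j e where "i \<in> I" "j \<in> I" "e \<in> {-1, 0, 1}" "z i \<noteq> z j"
      and se: "s = (e - (\<phi> i - \<phi> j)) / (z i - z j)"
      using s by (auto simp: S_def)
    have "(\<phi> i + s * z i) - (\<phi> j + s * z j) = \<phi> i - \<phi> j + s * (z i - z j)"
      by (simp add: algebra_simps)
    also have "\<dots> = e" using \<open>z i \<noteq> z j\<close> by (simp add: se)
    finally have "(\<phi> i + s * z i) - (\<phi> j + s * z j) \<in> {-1, 0, 1}"
      using \<open>e \<in> _\<close> by (simp only:)
    then have "(i, j) \<in> unit_links I (\<lambda>i. \<phi> i + s * z i)"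
      using \<open>i \<in> I\<close> \<open>j \<in> I\<close> unfolding unit_links_def by blast
    with \<open>z i \<noteq> z j\<close> show "\<exists>(i, j) \<in> unit_links I (\<lambda>i. \<phi> i + s * z i). z i \<noteq> z j" by blast
  qed
qed

text \<open>
  In the application \<open>\<kappa>\<close> sends a coordinate to its vertex, and \<open>E\<close> is the graph formed by a set of
  weights.
\<close>

definition balanced_potential ::
  "'i set \<Rightarrow> ('i \<Rightarrow> 'x) \<Rightarrow> ('i \<times> 'i) set \<Rightarrow> ('i \<Rightarrow> real) \<Rightarrow> bool" where
  "balanced_potential I \<kappa> E \<phi> \<longleftrightarrow>
     (\<forall>(i, j) \<in> E. \<phi> i - \<phi> j \<ge> 1) \<and> (\<forall>x. (\<Sum>i\<in>{i \<in> I. \<kappa> i = x}. \<phi> i) = 0)"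

text \<open>
  Take a potential with the largest number of pairs connected by chains of links.  A nonzero \<open>z\<close> with
  zero sums takes two different values, so sliding along it would produce a potential with more
  connected pairs.
\<close>

lemma exists_rigid_potential:
  fixes I :: "'i set"
  assumes "finite I" "E \<subseteq> I \<times> I" "balanced_potential I \<kappa> E \<phi>0"
  obtains \<phi> where "balanced_potential I \<kappa> E \<phi>"
    and "\<forall>z :: 'i \<Rightarrow> real. (\<forall>(i, j) \<in> unit_links I \<phi>. z i = z j) \<and>
      (\<forall>x. (\<Sum>i\<in>{i \<in> I. \<kappa> i = x}. z i) = 0) \<longrightarrow> (\<forall>i\<in>I. z i = 0)"
proof -
  let ?T = "\<lambda>\<phi>. (unit_links I \<phi>)\<^sup>+"
  have T_sub: "?T \<phi> \<subseteq> I \<times> I" for \<phi>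
    by (rule trancl_subset_Sigma) (auto simp: unit_links_def)
  have fin: "finite (?T \<phi>)" for \<phi>
    using T_sub assms(1) by (meson finite_SigmaI finite_subset)
  have "\<forall>\<phi>. balanced_potential I \<kappa> E \<phi> \<longrightarrow> card (?T \<phi>) < Suc (card (I \<times> I))"
    using T_sub assms(1) by (meson card_mono finite_SigmaI le_imp_less_Suc)
  from ex_has_greatest_nat[of "balanced_potential I \<kappa> E", OF assms(3) this]
  obtain \<phi> where bal: "balanced_potential I \<kappa> E \<phi>"
    and max: "\<And>\<psi>. balanced_potential I \<kappa> E \<psi> \<Longrightarrow> card (?T \<psi>) \<le> card (?T \<phi>)"
    by blast
  show thesis
  proof (rule that[OF bal], intro allI impI)
    fix z :: "'i \<Rightarrow> real"
    assume "(\<forall>(i, j) \<in> unit_links I \<phi>. z i = z j) \<and> (\<forall>x. (\<Sum>i\<in>{i \<in> I. \<kappa> i = x}. z i) = 0)"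
    then have const: "\<And>i j. (i, j) \<in> unit_links I \<phi> \<Longrightarrow> z i = z j"
      and sums: "\<And>x. (\<Sum>i\<in>{i \<in> I. \<kappa> i = x}. z i) = 0" by auto
    show "\<forall>i\<in>I. z i = 0"
    proof (rule ccontr)
      assume "\<not> (\<forall>i\<in>I. z i = 0)"
      then obtain i where i: "i \<in> I" "z i \<noteq> 0" by blast
      have "\<exists>j\<in>I. z i \<noteq> z j"
      proof (rule ccontr)
        assume "\<not> (\<exists>j\<in>I. z i \<noteq> z j)"
        then have "(\<Sum>j\<in>{j \<in> I. \<kappa> j = \<kappa> i}. z j) = (\<Sum>j\<in>{j \<in> I. \<kappa> j = \<kappa> i}. z i)"
          by (intro sum.cong) auto
        then have "card {j \<in> I. \<kappa> j = \<kappa> i} = 0" using sums[of "\<kappa> i"] i(2) by simp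
        then show False using i(1) assms(1) by auto
      qed
      then obtain j where j: "j \<in> I" "z i \<noteq> z j" by blast
      have feas: "\<And>i j. (i, j) \<in> E \<Longrightarrow> \<phi> i - \<phi> j \<ge> 1"
        using bal by (auto simp: balanced_potential_def)
      obtain s where s: "\<forall>(i, j) \<in> E. (\<phi> i + s * z i) - (\<phi> j + s * z j) \<ge> 1"
        and keep: "unit_links I \<phi> \<subseteq> unit_links I (\<lambda>i. \<phi> i + s * z i)"
        and new: "\<exists>(i, j) \<in> unit_links I (\<lambda>i. \<phi> i + s * z i). z i \<noteq> z j"
        by (rule slide_until_new_link[OF assms(1,2) feas const i(1) j])
      have "balanced_potential I \<kappa> E (\<lambda>i. \<phi> i + s * z i)"
        unfolding balanced_potential_def
      proof (intro conjI allI)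
        fix x
        have "(\<Sum>i\<in>{i \<in> I. \<kappa> i = x}. \<phi> i) = 0"
          using bal by (simp add: balanced_potential_def)
        then show "(\<Sum>i\<in>{i \<in> I. \<kappa> i = x}. \<phi> i + s * z i) = 0"
          using sums[of x] by (simp add: sum.distrib flip: sum_distrib_left)
      qed (rule s)
      from max[OF this] have le: "card (?T (\<lambda>i. \<phi> i + s * z i)) \<le> card (?T \<phi>)" .
      have "z i = z j" if "(i, j) \<in> ?T \<phi>" for i j
        using that by (induction rule: trancl_induct) (auto dest: const)
      with new have "?T (\<lambda>i. \<phi> i + s * z i) \<noteq> ?T \<phi>" by (blast dest: r_into_trancl)
      moreover have "?T \<phi> \<subseteq> ?T (\<lambda>i. \<phi> i + s * z i)"
        using trancl_mono[OF _ keep] by auto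
      ultimately have "?T \<phi> \<subset> ?T (\<lambda>i. \<phi> i + s * z i)" by blast
      from psubset_card_mono[OF fin this] le show False by simp
    qed
  qed
qed

lemma sum_over_labels:
  fixes z :: "nat \<Rightarrow> real"
  assumes "finite J" "g ` J \<subseteq> {..<c}"
  shows "(\<Sum>j<c. real (card {i \<in> J. g i = j}) * z j) = (\<Sum>i\<in>J. z (g i))"
proof -
  have "(\<Sum>j<c. real (card {i \<in> J. g i = j}) * z j) = (\<Sum>j<c. \<Sum>i\<in>{i \<in> J. g i = j}. z (g i))"
    by (intro sum.cong) auto
  also have "\<dots> = (\<Sum>i\<in>J. z (g i))" using assms by (intro sum.group) auto
  finally show ?thesis .
qed

text \<open>
  Numbering the classes turns the system for their positions into a matrix with columns indexed by
  natural numbers.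
\<close>

lemma equiv_labelling:
  assumes "finite I" "equiv I T"
  obtains g :: "'i \<Rightarrow> nat" and c where "g ` I = {..<c}"
    "\<And>i j. i \<in> I \<Longrightarrow> j \<in> I \<Longrightarrow> g i = g j \<longleftrightarrow> (i, j) \<in> T"
proof -
  have "finite (I // T)" using assms by (metis equiv_type finite_quotient)
  then obtain f where f: "bij_betw f (I // T) {..<card (I // T)}"
    by (metis ex_bij_betw_finite_nat atLeast0LessThan)
  show thesis
  proof (rule that)
    show "(\<lambda>i. f (T `` {i})) ` I = {..<card (I // T)}"
      using f by (auto simp: bij_betw_def quotient_def)
    fix i j assume ij: "i \<in> I" "j \<in> I"
    then have "f (T `` {i}) = f (T `` {j}) \<longleftrightarrow> T `` {i} = T `` {j}"
      using f by (intro inj_on_eq_iff[of f "I // T"]) (auto simp: bij_betw_def intro: quotientI)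
    also have "\<dots> \<longleftrightarrow> (i, j) \<in> T" using eq_equiv_class_iff[OF assms(2) ij] .
    finally show "f (T `` {i}) = f (T `` {j}) \<longleftrightarrow> (i, j) \<in> T" .
  qed
qed

text \<open>
  In a rigid potential write \<open>\<phi> i = \<tau> (g i) + h i\<close>, where \<open>\<tau>\<close> is the value at a representative of the class
  \<open>g i\<close> and \<open>h i\<close> is an integer with \<open>\<bar>h i\<bar> \<le> n - 1\<close>.  The vertex sums give a linear system for \<open>\<tau>\<close>
  whose matrix counts the coordinates at a vertex that lie in a class.  Rigidity says that its kernel is
  trivial, so Cramer's rule applies to suitable rows.
\<close>

lemma bounded_balanced_potential:
  fixes I :: "'i set"
  assumes fin: "finite I" and "E \<subseteq> I \<times> I" "balanced_potential I \<kappa> E \<phi>0"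
  obtains \<phi> where "balanced_potential I \<kappa> E \<phi>"
    and "\<And>i. i \<in> I \<Longrightarrow> \<bar>\<phi> i\<bar> \<le>
      real ((\<Prod>x\<in>\<kappa> ` I. card {i \<in> I. \<kappa> i = x}) * card I ^ card (\<kappa> ` I)) + (real (card I) - 1)"
proof -
  obtain \<phi> where bal: "balanced_potential I \<kappa> E \<phi>"
    and rigid: "\<forall>z :: 'i \<Rightarrow> real. (\<forall>(i, j) \<in> unit_links I \<phi>. z i = z j) \<and>
      (\<forall>x. (\<Sum>i\<in>{i \<in> I. \<kappa> i = x}. z i) = 0) \<longrightarrow> (\<forall>i\<in>I. z i = 0)"
    by (rule exists_rigid_potential[OF assms])
  define fib where "fib x = {i \<in> I. \<kappa> i = x}" for x
  define X where "X = \<kappa> ` I"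
  define n where "n = card I"
  have fin_fib: "finite (fib x)" for x using fin by (simp add: fib_def)
  have fin_X: "finite X" using fin by (simp add: X_def)
  obtain g and c :: nat where g: "g ` I = {..<c}"
    and g_eq: "\<And>i j. i \<in> I \<Longrightarrow> j \<in> I \<Longrightarrow> g i = g j \<longleftrightarrow> (i, j) \<in> (unit_links I \<phi>)\<^sup>+"
    using equiv_labelling[OF fin equiv_unit_links] by metis
  define \<rho> where "\<rho> = inv_into I g"
  have \<rho>: "\<rho> j \<in> I" "g (\<rho> j) = j" if "j < c" for j
    using that g by (auto simp: \<rho>_def inv_into_into f_inv_into_f)
  define \<tau> where "\<tau> j = \<phi> (\<rho> j)" for j
  define h where "h i = \<phi> i - \<tau> (g i)" for i
  have link: "(\<rho> (g i), i) \<in> (unit_links I \<phi>)\<^sup>+" if "i \<in> I" for i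
    using that g \<rho>[of "g i"] by (subst g_eq[symmetric]) auto
  have h_bound: "\<bar>h i\<bar> \<le> real n - 1" if "i \<in> I" for i
    using linked_differences_bounded(2)[OF fin link[OF that]] by (simp add: h_def \<tau>_def n_def)
  define A where "A x j = real (card {i \<in> fib x. g i = j})" for x j
  have A_sum: "(\<Sum>j<c. A x j * z j) = (\<Sum>i\<in>fib x. z (g i))" for x z
    unfolding A_def using g by (intro sum_over_labels fin_fib) (auto simp: fib_def)
  have kernel: "\<forall>j<c. z j = 0" if "\<And>x. x \<in> X \<Longrightarrow> (\<Sum>j<c. A x j * z j) = 0" for z
  proof -
    have "\<forall>i\<in>I. z (g i) = 0"
    proof (rule rigid[THEN spec, THEN mp], intro conjI ballI allI)
      fix p assume p: "p \<in> unit_links I \<phi>"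
      obtain i j where ij: "p = (i, j)" by fastforce
      with p have "g i = g j" by (subst g_eq) (auto simp: unit_links_def)
      then show "case p of (i, j) \<Rightarrow> z (g i) = z (g j)" using ij by simp
    next
      fix x
      show "(\<Sum>i\<in>{i \<in> I. \<kappa> i = x}. z (g i)) = 0"
      proof (cases "x \<in> X")
        case True
        then show ?thesis using that A_sum by (simp add: fib_def)
      next
        case False
        then have "{i \<in> I. \<kappa> i = x} = {}" by (auto simp: X_def)
        then show ?thesis by (simp only: sum.empty)
      qed
    qed
    then show ?thesis using g by (metis imageE lessThan_iff)
  qed
  \<comment> \<open>one vertex for each class, such that the equations of these vertices determine \<open>\<tau>\<close>\<close>
  obtain r where r: "r ` {..<c} \<subseteq> X"
    and nz: "Determinant.det (Matrix.mat c c (\<lambda>(i, j). A (r i) j)) \<noteq> 0"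
    using exists_nonsingular_rows[where X = X and c = c and A = A] kernel by blast
  define M where "M = Matrix.mat c c (\<lambda>(i, j). A (r i) j)"
  have M: "M \<in> carrier_mat c c" by (simp add: M_def)
  have inj: "inj_on r {..<c}"
  proof (rule inj_onI, rule ccontr)
    fix i j assume ij: "i \<in> {..<c}" "j \<in> {..<c}" "r i = r j" "i \<noteq> j"
    then have "Matrix.row M i = Matrix.row M j" by (intro eq_vecI) (auto simp: M_def)
    then have "Determinant.det M = 0" using ij by (intro det_identical_rows[OF M, of i j]) auto
    then show False using nz by (simp add: M_def)
  qed
  have "Determinant.det M \<in> \<int>"
    unfolding det_def'[OF M]
  proof (intro Ints_sum Ints_mult Ints_prod)
    fix p i assume "p \<in> {p. p permutes {0..<c}}" "i \<in> {0..<c}"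
    then have "i < c" "p i < c" using permutes_in_image[of p "{0..<c}" i] by auto
    then show "M $$ (i, p i) \<in> \<int>" by (simp add: M_def A_def)
  qed (simp add: sign_def)
  then have "1 \<le> \<bar>Determinant.det M\<bar>"
    using nz by (intro Ints_nonzero_abs_ge1) (auto simp: M_def)
  define b where "b i = - (\<Sum>l\<in>fib (r i). h l)" for i
  have system: "M *\<^sub>v Matrix.vec c \<tau> = Matrix.vec c b"
  proof (rule eq_vecI)
    fix i assume "i < dim_vec (Matrix.vec c b)"
    then have i: "i < c" by simp
    have "(M *\<^sub>v Matrix.vec c \<tau>) $ i = (\<Sum>j<c. A (r i) j * \<tau> j)"
      using i by (simp add: M_def scalar_prod_def atLeast0LessThan)
    also have "\<dots> = (\<Sum>l\<in>fib (r i). \<phi> l - h l)" by (simp add: A_sum h_def)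
    also have "\<dots> = b i"
      using bal by (simp add: sum_subtractf b_def balanced_potential_def fib_def)
    finally show "(M *\<^sub>v Matrix.vec c \<tau>) $ i = Matrix.vec c b $ i" using i by simp
  qed (simp add: M_def)
  have b_bound: "\<bar>b i\<bar> \<le> real (card (fib (r i))) * (real n - 1)" for i
  proof -
    have "\<bar>b i\<bar> \<le> (\<Sum>l\<in>fib (r i). \<bar>h l\<bar>)" unfolding b_def abs_minus_cancel by (rule sum_abs)
    also have "\<dots> \<le> (\<Sum>l\<in>fib (r i). real n - 1)"
      by (rule sum_mono) (auto simp: fib_def intro: h_bound)
    finally show ?thesis by simp
  qed
  have \<tau>_bound: "\<bar>\<tau> k\<bar> \<le> real ((\<Prod>x\<in>X. card (fib x)) * n ^ card X)" if k: "k < c" for k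
  proof -
    let ?R = "replace_col M (Matrix.vec c b) k"
    have R: "?R \<in> carrier_mat c c" using M by (auto simp: replace_col_def)
    have row: "(\<Sum>j<c. \<bar>?R $$ (i, j)\<bar>) \<le> real (card (fib (r i)) * n)" if i: "i < c" for i
    proof -
      have "(\<Sum>j<c. \<bar>?R $$ (i, j)\<bar>) \<le> (\<Sum>j<c. A (r i) j * 1 + (if j = k then \<bar>b i\<bar> else 0))"
        using i by (intro sum_mono) (auto simp: replace_col_def M_def A_def)
      \<comment> \<open>the entries of the original row count the fibre of \<open>r i\<close>, split into classes\<close>
      also have "\<dots> = real (card (fib (r i))) + \<bar>b i\<bar>"
        using k by (simp only: sum.distrib A_sum) simp
      also have "\<dots> \<le> real (card (fib (r i)) * n)"
        using b_bound[of i] by (simp add: algebra_simps)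
      finally show ?thesis .
    qed
    have c_le: "c \<le> card X"
      using card_image[OF inj] card_mono[OF fin_X r] by simp
    have "\<bar>\<tau> k\<bar> \<le> \<bar>\<tau> k\<bar> * \<bar>Determinant.det M\<bar>"
      using \<open>1 \<le> _\<close> by (simp add: mult_le_cancel_left1)
    also have "\<dots> = \<bar>Determinant.det ?R\<bar>"
      using cramer_lemma_mat[OF M _ k, of "Matrix.vec c \<tau>"] k
      by (simp add: system abs_mult)
    also have "\<dots> \<le> (\<Prod>i<c. \<Sum>j<c. \<bar>?R $$ (i, j)\<bar>)" by (rule abs_det_le_prod_row_sums[OF R])
    also have "\<dots> \<le> (\<Prod>i<c. real (card (fib (r i)) * n))"
      by (rule prod_mono) (simp add: row sum_nonneg del: of_nat_mult)
    also have "\<dots> = real ((\<Prod>i<c. card (fib (r i))) * n ^ c)"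
      by (simp add: prod.distrib)
    also have "\<dots> \<le> real ((\<Prod>x\<in>X. card (fib x)) * n ^ card X)"
    proof -
      have pos: "0 < card (fib x)" if "x \<in> X" for x
        using that fin by (auto simp: X_def fib_def card_gt_0_iff)
      have "(\<Prod>i<c. card (fib (r i))) = (\<Prod>x\<in>r ` {..<c}. card (fib x))"
        using inj by (simp add: prod.reindex)
      also have "\<dots> \<le> (\<Prod>x\<in>X. card (fib x))"
      proof -
        have "0 < (\<Prod>x\<in>X - r ` {..<c}. card (fib x))" using pos by (intro prod_pos) auto
        then show ?thesis by (simp add: prod.subset_diff[OF r fin_X])
      qed
      finally have *: "(\<Prod>i<c. card (fib (r i))) \<le> (\<Prod>x\<in>X. card (fib x))" .
      have "0 < n" using \<rho>(1)[OF k] fin by (auto simp: n_def card_gt_0_iff)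
      then have "n ^ c \<le> n ^ card X" using c_le by (intro power_increasing) auto
      with * show ?thesis by (intro of_nat_mono mult_le_mono)
    qed
    finally show ?thesis .
  qed
  show thesis
  proof (rule that[OF bal])
    fix i assume i: "i \<in> I"
    then have "\<bar>\<phi> i\<bar> \<le> \<bar>\<tau> (g i)\<bar> + \<bar>h i\<bar>" by (simp add: h_def)
    also have "\<dots> \<le> real ((\<Prod>x\<in>X. card (fib x)) * n ^ card X) + (real n - 1)"
      using i g by (intro add_mono \<tau>_bound h_bound) auto
    finally show "\<bar>\<phi> i\<bar> \<le>
      real ((\<Prod>x\<in>\<kappa> ` I. card {i \<in> I. \<kappa> i = x}) * card I ^ card (\<kappa> ` I)) + (real (card I) - 1)"
      by (simp add: X_def fib_def n_def)
  qed
qed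

section \<open>Convex hulls and the weight margin\<close>

lemma lookup_scaleR: "Poly_Mapping.lookup (c *\<^sub>R v) i = c *\<^sub>R Poly_Mapping.lookup v i"
proof -
  have "finite {i. c *\<^sub>R Poly_Mapping.lookup v i \<noteq> 0}"
    by (rule finite_subset[OF _ finite_lookup[of v]]) auto
  then show ?thesis
    by (simp add: scaleR_poly_mapping_def Abs_poly_mapping_inverse)
qed

text \<open>
  The standard inner product when the support of \<open>v\<close> lies in \<open>I\<close>, with \<open>\<phi>\<close> viewed as a linear
  functional.
\<close>

definition pairing :: "'i set \<Rightarrow> ('i \<Rightarrow> real) \<Rightarrow> ('i \<Rightarrow>\<^sub>0 real) \<Rightarrow> real" where
  "pairing I \<phi> v = (\<Sum>i\<in>I. \<phi> i * Poly_Mapping.lookup v i)"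

lemma pairing_add: "pairing I \<phi> (u + v) = pairing I \<phi> u + pairing I \<phi> v"
  by (simp add: pairing_def lookup_add algebra_simps sum.distrib)

lemma pairing_scaleR: "pairing I \<phi> (c *\<^sub>R v) = c * pairing I \<phi> v"
  by (simp add: pairing_def lookup_scaleR sum_distrib_left algebra_simps)

lemma pairing_ge_on_convex_hull:
  assumes "\<And>v. v \<in> \<Gamma> \<Longrightarrow> b \<le> pairing I \<phi> v" "v \<in> convex hull \<Gamma>"
  shows "b \<le> pairing I \<phi> v"
proof -
  have "convex {v. b \<le> pairing I \<phi> v}"
  proof (rule convexI, clarify)
    fix u v :: "'a \<Rightarrow>\<^sub>0 real" and s t :: real
    assume "b \<le> pairing I \<phi> u" "b \<le> pairing I \<phi> v" "0 \<le> s" "0 \<le> t" "s + t = 1"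
    then have "s * b + t * b \<le> s * pairing I \<phi> u + t * pairing I \<phi> v"
      by (intro add_mono mult_left_mono)
    moreover have "s * b + t * b = b" using \<open>s + t = 1\<close> by (metis distrib_right mult_1)
    ultimately show "b \<le> pairing I \<phi> (s *\<^sub>R u + t *\<^sub>R v)"
      by (simp add: pairing_add pairing_scaleR)
  qed
  then have "convex hull \<Gamma> \<subseteq> {v. b \<le> pairing I \<phi> v}"
    using assms(1) by (intro hull_minimal) auto
  then show ?thesis using assms(2) by auto
qed

lemma keys_convex_hull:
  fixes \<Gamma> :: "('i \<Rightarrow>\<^sub>0 real) set"
  assumes "\<And>v. v \<in> \<Gamma> \<Longrightarrow> Poly_Mapping.keys v \<subseteq> I" "v \<in> convex hull \<Gamma>"
  shows "Poly_Mapping.keys v \<subseteq> I"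
proof -
  have "{v :: 'i \<Rightarrow>\<^sub>0 real. Poly_Mapping.keys v \<subseteq> I} = {v. \<forall>i. i \<notin> I \<longrightarrow> Poly_Mapping.lookup v i = 0}"
    by (auto simp: in_keys_iff)
  then have "convex {v :: 'i \<Rightarrow>\<^sub>0 real. Poly_Mapping.keys v \<subseteq> I}"
    by (simp add: convex_def lookup_add lookup_scaleR)
  then have "convex hull \<Gamma> \<subseteq> {v. Poly_Mapping.keys v \<subseteq> I}"
    using assms(1) by (intro hull_minimal) auto
  then show ?thesis using assms(2) by auto
qed

lemma norm2_eq_L2_set:
  assumes "finite I" "Poly_Mapping.keys v \<subseteq> I"
  shows "norm2 v = L2_set (Poly_Mapping.lookup v) I"
  unfolding norm2_def L2_set_def
  by (intro arg_cong[of _ _ sqrt] sum.mono_neutral_left assms) (auto simp: in_keys_iff)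

text \<open>
  A functional of length at most \<open>B\<close> that is at least \<open>1\<close> on \<open>\<Gamma>\<close> is at least \<open>1\<close> on the whole hull, and by
  Cauchy--Schwarz every point of the hull then has length at least \<open>1 / B\<close>.
\<close>

lemma weight_margin_ge:
  assumes fin: "finite I" and keys: "\<And>v. v \<in> \<Omega> \<Longrightarrow> Poly_Mapping.keys v \<subseteq> I" and "0 < B"
    and potential: "\<And>\<Gamma>. \<Gamma> \<noteq> {} \<Longrightarrow> \<Gamma> \<subseteq> \<Omega> \<Longrightarrow> 0 \<notin> convex hull \<Gamma> \<Longrightarrow>
      \<exists>\<phi>. (\<forall>v\<in>\<Gamma>. 1 \<le> pairing I \<phi> v) \<and> L2_set \<phi> I \<le> B"
  shows "ereal (1 / B) \<le> weight_margin \<Omega>"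
  unfolding weight_margin_def
proof (rule INF_greatest, clarify)
  fix \<Gamma> assume \<Gamma>: "\<Gamma> \<noteq> {}" "\<Gamma> \<subseteq> \<Omega>" "0 \<notin> convex hull \<Gamma>"
  then obtain \<phi> where \<phi>: "\<forall>v\<in>\<Gamma>. 1 \<le> pairing I \<phi> v" "L2_set \<phi> I \<le> B"
    using potential by blast
  have "1 / B \<le> (INF v\<in>convex hull \<Gamma>. norm2 v)"
  proof (rule cINF_greatest)
    fix v assume v: "v \<in> convex hull \<Gamma>"
    have "1 \<le> pairing I \<phi> v" using \<phi>(1) v pairing_ge_on_convex_hull by blast
    also have "\<dots> \<le> (\<Sum>i\<in>I. \<bar>\<phi> i\<bar> * \<bar>Poly_Mapping.lookup v i\<bar>)"
      unfolding pairing_def by (intro sum_mono) (simp flip: abs_mult)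
    also have "\<dots> \<le> L2_set \<phi> I * L2_set (Poly_Mapping.lookup v) I" by (rule L2_set_mult_ineq)
    also have "\<dots> = L2_set \<phi> I * norm2 v"
      using keys_convex_hull[of \<Gamma> I v] v \<Gamma>(2) keys by (subst norm2_eq_L2_set[OF fin]) auto
    also have "\<dots> \<le> B * norm2 v"
      using \<phi>(2) by (intro mult_right_mono) (simp_all add: norm2_def L2_set_nonneg)
    finally show "1 / B \<le> norm2 v" using \<open>0 < B\<close> by (simp add: field_simps)
  qed (use \<Gamma>(1) in simp)
  then show "ereal (1 / B) \<le> ereal (INF v\<in>convex hull \<Gamma>. norm2 v)" by simp
qed

lemma continuous_on_lookup:
  fixes S :: "('i \<Rightarrow>\<^sub>0 'b :: real_normed_vector) set"
  shows "continuous_on S (\<lambda>v. Poly_Mapping.lookup v i)"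
proof (rule continuous_on_iff[THEN iffD2], intro ballI allI impI)
  fix u :: "'i \<Rightarrow>\<^sub>0 'b" and e :: real assume "0 < e"
  have le: "dist (Poly_Mapping.lookup v i) (Poly_Mapping.lookup u i) \<le> dist v u" for v
  proof (cases "i \<in> Poly_Mapping.keys v \<union> Poly_Mapping.keys u")
    case True
    then show ?thesis unfolding dist_poly_mapping_def by (intro member_le_sum) auto
  next
    case False
    then show ?thesis by (simp add: in_keys_iff)
  qed
  show "\<exists>\<delta>>0. \<forall>v\<in>S. dist v u < \<delta> \<longrightarrow> dist (Poly_Mapping.lookup v i) (Poly_Mapping.lookup u i) < e"
    using \<open>0 < e\<close> le by (meson le_less_trans)
qed

text \<open>
  The point \<open>m\<close> of least Euclidean norm in the compact hull is nonzero.  Its inner product with each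
  point of the hull is at least \<open>\<parallel>m\<parallel>\<^sup>2\<close>, since otherwise a small step from \<open>m\<close> towards that point would decrease
  the norm.  Hence \<open>m / \<parallel>m\<parallel>\<^sup>2\<close> is the functional.
\<close>

lemma separating_functional:
  assumes fin: "finite \<Gamma>" and keys: "\<And>v. v \<in> \<Gamma> \<Longrightarrow> Poly_Mapping.keys v \<subseteq> I" and finI: "finite I"
    and zero: "0 \<notin> convex hull \<Gamma>"
  obtains \<phi> where "\<forall>v\<in>\<Gamma>. 1 \<le> pairing I \<phi> v"
proof (cases "\<Gamma> = {}")
  case True
  then show ?thesis using that by blast
next
  case False
  define q where "q v = pairing I (Poly_Mapping.lookup v) v" for v
  have "compact (convex hull \<Gamma>)" by (rule finite_imp_compact_convex_hull[OF fin])
  moreover have "convex hull \<Gamma> \<noteq> {}" using False by simp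
  moreover have "continuous_on (convex hull \<Gamma>) q"
    unfolding q_def pairing_def by (intro continuous_intros continuous_on_lookup)
  ultimately obtain m where m: "m \<in> convex hull \<Gamma>"
    and least: "\<And>v. v \<in> convex hull \<Gamma> \<Longrightarrow> q m \<le> q v"
    by (metis continuous_attains_inf)
  have q_nonneg: "0 \<le> q v" for v by (simp add: q_def pairing_def sum_nonneg)
  have "q m \<noteq> 0"
  proof
    assume "q m = 0"
    then have "\<forall>i\<in>I. Poly_Mapping.lookup m i = 0"
      using finI by (simp add: q_def pairing_def sum_nonneg_eq_0_iff)
    moreover have "Poly_Mapping.keys m \<subseteq> I" using keys m by (rule keys_convex_hull)
    ultimately have "m = 0" by (intro poly_mapping_eqI) (auto simp: subset_iff in_keys_iff)
    then show False using m zero by simp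
  qed
  then have pos: "0 < q m" using q_nonneg[of m] by simp
  have "q m \<le> pairing I (Poly_Mapping.lookup m) v" if v: "v \<in> \<Gamma>" for v
  proof (rule ccontr)
    define a D where "a = pairing I (Poly_Mapping.lookup m) (v - m)" and "D = q (v - m)"
    have "q (m + t *\<^sub>R w) = q m + t * (2 * pairing I (Poly_Mapping.lookup m) w + t * q w)" for t w
      unfolding q_def pairing_def
      by (simp add: lookup_add lookup_scaleR algebra_simps sum.distrib sum_distrib_left)
    then have expand: "q (m + t *\<^sub>R (v - m)) = q m + t * (2 * a + t * D)" for t
      by (simp add: a_def D_def)
    assume "\<not> ?thesis"
    then have "a < 0"
      using pairing_add[of I "Poly_Mapping.lookup m" m "v - m"] by (simp add: a_def q_def)
    have "0 \<le> D" by (simp add: D_def q_nonneg)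
    \<comment> \<open>a step for which the first-order decrease \<open>2 a\<close> outweighs the second-order term \<open>t D\<close>\<close>
    define t where "t = min 1 (- a / (D + 1))"
    have "0 < D + 1" using \<open>0 \<le> D\<close> by simp
    then have t: "0 < t" "t \<le> 1" "t * (D + 1) \<le> - a"
      using \<open>a < 0\<close> by (simp_all add: t_def divide_neg_pos flip: pos_le_divide_eq)
    have "(1 - t) *\<^sub>R m + t *\<^sub>R v \<in> convex hull \<Gamma>"
      using t v m by (intro convexD convex_convex_hull) (auto intro: hull_inc)
    moreover have "(1 - t) *\<^sub>R m + t *\<^sub>R v = m + t *\<^sub>R (v - m)" by (simp add: algebra_simps)
    ultimately have "q m \<le> q m + t * (2 * a + t * D)" using least expand by metis
    moreover have "2 * a + t * D < 0" using t \<open>a < 0\<close> by (simp add: algebra_simps)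
    then have "t * (2 * a + t * D) < 0" using t(1) by (simp add: mult_pos_neg)
    ultimately show False by simp
  qed
  moreover have "pairing I (\<lambda>i. Poly_Mapping.lookup m i / q m) v
      = pairing I (Poly_Mapping.lookup m) v / q m" for v
    by (simp add: pairing_def sum_divide_distrib)
  ultimately have "\<forall>v\<in>\<Gamma>. 1 \<le> pairing I (\<lambda>i. Poly_Mapping.lookup m i / q m) v"
    using pos by simp
  then show ?thesis using that by blast
qed

lemma L2_set_le_of_bounded:
  assumes "\<And>i. i \<in> I \<Longrightarrow> \<bar>\<phi> i\<bar> \<le> b" "0 \<le> b"
  shows "L2_set \<phi> I \<le> sqrt (card I) * b"
proof -
  have "L2_set \<phi> I = L2_set (\<lambda>i. \<bar>\<phi> i\<bar>) I" by (simp add: L2_set_def)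
  also have "\<dots> \<le> L2_set (\<lambda>i. b) I" by (rule L2_set_mono) (use assms in auto)
  also have "\<dots> = sqrt (card I) * b" using assms(2) by (simp add: L2_set_def real_sqrt_mult)
  finally show ?thesis .
qed

text \<open>
  Only the order of the values of \<open>\<phi>\<close> matters: the number of smaller values also grows by at
  least \<open>1\<close> when \<open>\<phi>\<close> strictly increases.
\<close>

lemma rank_potential:
  fixes \<phi> :: "'i \<Rightarrow> real"
  assumes "finite I" "\<And>i j. (i, j) \<in> E \<Longrightarrow> 1 \<le> \<phi> i - \<phi> j" "E \<subseteq> I \<times> I"
  obtains h :: "'i \<Rightarrow> real" where "\<And>i j. (i, j) \<in> E \<Longrightarrow> 1 \<le> h i - h j"
    and "\<And>i. \<bar>h i\<bar> \<le> card I"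
proof -
  define below where "below i = {l \<in> I. \<phi> l < \<phi> i}" for i
  have fin: "finite (below i)" for i using assms(1) by (simp add: below_def)
  show thesis
  proof (rule that)
    fix i j assume ij: "(i, j) \<in> E"
    then have lt: "\<phi> j < \<phi> i" "j \<in> I" using assms(2)[of i j] assms(3) by auto
    have "below j \<subset> below i"
      using lt by (auto simp: below_def)
    then have "card (below j) < card (below i)" by (rule psubset_card_mono[OF fin])
    then show "1 \<le> real (card (below i)) - real (card (below j))" by linarith
  next
    fix i
    have "card (below i) \<le> card I" using assms(1) by (auto simp: below_def intro: card_mono)
    then show "\<bar>real (card (below i))\<bar> \<le> card I" by simp
  qed
qed

section \<open>The weights of a quiver representation\<close>

text \<open>
  For \<open>p \<noteq> q\<close> these are the roots of the general linear group; \<open>p = q\<close> gives the zero weight, which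
  occurs for diagonal entries at loops.
\<close>

definition root_vec :: "'i \<Rightarrow> 'i \<Rightarrow> 'i \<Rightarrow>\<^sub>0 int" where
  "root_vec p q = Poly_Mapping.single p 1 - Poly_Mapping.single q 1"

lemma lookup_root: "Poly_Mapping.lookup (root_vec p q) c = of_bool (c = p) - of_bool (c = q)"
  by (auto simp: root_vec_def lookup_minus lookup_single when_def)

lemma prod_powi_root:
  fixes t :: "'i \<Rightarrow> 'b :: field"
  assumes "finite C" "p \<in> C" "q \<in> C" "\<And>c. c \<in> C \<Longrightarrow> t c \<noteq> 0"
  shows "(\<Prod>c\<in>C. t c powi Poly_Mapping.lookup (root_vec p q) c) = t p * inverse (t q)"
proof -
  have "(\<Prod>c\<in>C. t c powi Poly_Mapping.lookup (root_vec p q) c)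
      = (\<Prod>c\<in>C. (if c = p then t c else 1) * (if c = q then inverse (t c) else 1))"
    using assms(4) by (intro prod.cong) (auto simp: lookup_root power_int_minus)
  also have "\<dots> = t p * inverse (t q)" using assms(1-3) by (simp add: prod.distrib prod.delta)
  finally show ?thesis .
qed

lemma inv_GL_mat_diag:
  assumes "\<And>i. i < m \<Longrightarrow> t i \<noteq> 0"
  shows "inv\<^bsub>GL m\<^esub> (mat_diag m t) = mat_diag m (\<lambda>i. inverse (t i))"
proof -
  interpret R: ring "ring_mat TYPE(complex) m ()" by (rule ring_mat)
  let ?R = "ring_mat TYPE(complex) m ()"
  let ?s = "mat_diag m (\<lambda>i. inverse (t i))"
  have "mat_diag m (\<lambda>i. t i * inverse (t i)) = 1\<^sub>m m"
    "mat_diag m (\<lambda>i. inverse (t i) * t i) = 1\<^sub>m m"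
    using assms by (auto intro!: eq_matI simp: mat_diag_def)
  then have ts: "mat_diag m t * ?s = 1\<^sub>m m" "?s * mat_diag m t = 1\<^sub>m m" by simp_all
  have "mat_diag m t \<in> Units ?R"
    unfolding Units_def using ts by (auto simp: ring_mat_simps intro!: bexI[of _ ?s])
  then have "inv\<^bsub>GL m\<^esub> (mat_diag m t) = inv\<^bsub>?R\<^esub> (mat_diag m t)"
    unfolding GL_def by (rule R.units_of_inv)
  also have "\<dots> = ?s"
    using ts by (intro R.inv_unique'[symmetric]) (auto simp: ring_mat_simps)
  finally show ?thesis .
qed

lemma quiver_rep_torus:
  assumes "wf_digraph Q" "a \<in> arcs Q" "w \<in> quiver_space Q d" "\<And>p. p \<in> coords Q d \<Longrightarrow> t p \<noteq> 0"
  shows "quiver_rep Q d (torus_elem Q d t) w a = Matrix.mat (d (head Q a)) (d (tail Q a))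
    (\<lambda>(i, j). t (head Q a, i) * inverse (t (tail Q a, j)) * w a $$ (i, j))"
proof -
  have V: "head Q a \<in> verts Q" "tail Q a \<in> verts Q"
    using assms(1,2) by (auto simp: wf_digraph_def)
  have W: "w a \<in> carrier_mat (d (head Q a)) (d (tail Q a))"
    using assms(2,3) by (auto simp: quiver_space_def)
  have inv: "inv\<^bsub>GL (d (tail Q a))\<^esub> (mat_diag (d (tail Q a)) (\<lambda>i. t (tail Q a, i)))
      = mat_diag (d (tail Q a)) (\<lambda>i. inverse (t (tail Q a, i)))"
    using V assms(4) by (intro inv_GL_mat_diag) (auto simp: coords_def)
  show ?thesis
    using assms(2) V W
    by (auto simp: quiver_rep_def torus_elem_def inv mat_diag_mult_left[OF W]
        mat_diag_mult_right[of _ "d (head Q a)"] intro!: eq_matI)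
qed

text \<open>
  A torus element with entry \<open>2\<close> at one coordinate therefore detects the exponent of a character there.
\<close>

lemma powi_two_inject:
  assumes "(2 :: complex) powi m = 2 powi n"
  shows "m = n"
proof -
  have "(2 :: real) powi m = 2 powi n" using arg_cong[OF assms, of norm] by (simp add: norm_power_int)
  then show ?thesis
    using power_int_strict_increasing[of m n "2 :: real"] power_int_strict_increasing[of n m "2 :: real"]
    by (cases m n rule: linorder_cases) auto
qed

text \<open>
  The torus scales the entry \<open>(i, j)\<close> of the matrix at \<open>a\<close> by \<open>t\<^sub>p t\<^sub>q\<^sup>-\<^sup>1\<close>, where \<open>p = (head a, i)\<close> and
  \<open>q = (tail a, j)\<close>.  A nonzero entry of a weight vector thus determines the character, and so the
  exponents; conversely matrix units are weight vectors.
\<close>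

lemma weights_eq_roots:
  assumes "fin_digraph Q"
  shows "weights Q d = {root_vec (head Q a, i) (tail Q a, j) | a i j.
    a \<in> arcs Q \<and> i < d (head Q a) \<and> j < d (tail Q a)}"
proof -
  interpret fin_digraph Q by (rule assms)
  have fin: "finite (coords Q d)" by (simp add: coords_def)
  have coords: "(head Q a, i) \<in> coords Q d" "(tail Q a, j) \<in> coords Q d"
    if "a \<in> arcs Q" "i < d (head Q a)" "j < d (tail Q a)" for a i j
    using that by (auto simp: coords_def)
  show ?thesis
  proof (intro equalityI subsetI)
    fix \<omega> assume "\<omega> \<in> weights Q d"
    then obtain w where keys: "Poly_Mapping.keys \<omega> \<subseteq> coords Q d"
      and w: "w \<in> quiver_space Q d" "w \<noteq> quiver_zero Q d"
      and eigen: "\<And>t. (\<And>p. p \<in> coords Q d \<Longrightarrow> t p \<noteq> 0) \<Longrightarrow>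
        quiver_rep Q d (torus_elem Q d t) w =
        quiver_smult Q (\<Prod>p\<in>coords Q d. t p powi Poly_Mapping.lookup \<omega> p) w"
      unfolding weights_def by blast
    have W: "w a \<in> carrier_mat (d (head Q a)) (d (tail Q a))" if "a \<in> arcs Q" for a
      using w(1) that by (auto simp: quiver_space_def)
    have "\<exists>a\<in>arcs Q. w a \<noteq> 0\<^sub>m (d (head Q a)) (d (tail Q a))"
    proof (rule ccontr)
      assume "\<not> ?thesis"
      then have "w = quiver_zero Q d"
        using w(1) by (auto simp: quiver_zero_def quiver_space_def fun_eq_iff PiE_iff extensional_def)
      then show False using w(2) by simp
    qed
    then obtain a i j where a: "a \<in> arcs Q" "i < d (head Q a)" "j < d (tail Q a)"
      and nz: "w a $$ (i, j) \<noteq> 0"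
      using W by (metis carrier_matD(1) carrier_matD(2) eq_matI index_zero_mat(1-3))
    let ?\<rho> = "root_vec (head Q a, i) (tail Q a, j)"
    have char: "(\<Prod>p\<in>coords Q d. t p powi Poly_Mapping.lookup \<omega> p)
        = (\<Prod>p\<in>coords Q d. t p powi Poly_Mapping.lookup ?\<rho> p)"
      if t: "\<And>p. p \<in> coords Q d \<Longrightarrow> t p \<noteq> 0" for t :: "'a \<times> nat \<Rightarrow> complex"
    proof -
      have "quiver_rep Q d (torus_elem Q d t) w a $$ (i, j)
          = t (head Q a, i) * inverse (t (tail Q a, j)) * w a $$ (i, j)"
        using a by (simp add: quiver_rep_torus[OF wf_digraph_axioms a(1) w(1) t])
      moreover have "quiver_rep Q d (torus_elem Q d t) w a $$ (i, j)
          = (\<Prod>p\<in>coords Q d. t p powi Poly_Mapping.lookup \<omega> p) * w a $$ (i, j)"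
        using a W[OF a(1)] by (simp add: eigen[OF t] quiver_smult_def)
      moreover have "(\<Prod>p\<in>coords Q d. t p powi Poly_Mapping.lookup ?\<rho> p)
          = t (head Q a, i) * inverse (t (tail Q a, j))"
        using coords[OF a] t by (intro prod_powi_root fin)
      ultimately show ?thesis using nz by (metis mult_right_cancel)
    qed
    have "Poly_Mapping.lookup \<omega> p = Poly_Mapping.lookup ?\<rho> p" for p
    proof (cases "p \<in> coords Q d")
      case True
      \<comment> \<open>the character evaluated at the torus element with entry \<open>2\<close> at \<open>p\<close> and \<open>1\<close> elsewhere\<close>
      have probe: "(\<Prod>c\<in>coords Q d. (if c = p then 2 else 1) powi Poly_Mapping.lookup \<nu> c)
          = (2 :: complex) powi Poly_Mapping.lookup \<nu> p" for \<nu>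
      proof -
        have "(\<Prod>c\<in>coords Q d. (if c = p then 2 else 1) powi Poly_Mapping.lookup \<nu> c)
            = (\<Prod>c\<in>coords Q d. if c = p then (2 :: complex) powi Poly_Mapping.lookup \<nu> c else 1)"
          by (intro prod.cong) auto
        then show ?thesis using True fin by simp
      qed
      show ?thesis
        using char[of "\<lambda>c. if c = p then 2 else 1"] by (intro powi_two_inject) (simp add: probe)
    next
      case False
      then have "Poly_Mapping.lookup \<omega> p = 0" using keys by (auto simp: in_keys_iff)
      moreover have "Poly_Mapping.lookup ?\<rho> p = 0" using False coords[OF a] by (auto simp: lookup_root)
      ultimately show ?thesis by simp
    qed
    then have "\<omega> = ?\<rho>" by (rule poly_mapping_eqI)
    then show "\<omega> \<in> {root_vec (head Q a, i) (tail Q a, j) | a i j.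
        a \<in> arcs Q \<and> i < d (head Q a) \<and> j < d (tail Q a)}"
      using a by blast
  next
    fix \<omega> assume "\<omega> \<in> {root_vec (head Q a, i) (tail Q a, j) | a i j.
        a \<in> arcs Q \<and> i < d (head Q a) \<and> j < d (tail Q a)}"
    then obtain a i j where a: "a \<in> arcs Q" "i < d (head Q a)" "j < d (tail Q a)"
      and \<omega>: "\<omega> = root_vec (head Q a, i) (tail Q a, j)" by blast
    define w where "w = (\<lambda>b\<in>arcs Q. Matrix.mat (d (head Q b)) (d (tail Q b))
      (\<lambda>(k, l). if b = a \<and> k = i \<and> l = j then 1 else 0 :: complex))"
    have w: "w \<in> quiver_space Q d" by (auto simp: w_def quiver_space_def)
    have "w a $$ (i, j) = 1" using a by (simp add: w_def)
    moreover have "quiver_zero Q d a $$ (i, j) = 0" using a by (simp add: quiver_zero_def)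
    ultimately have "w \<noteq> quiver_zero Q d" by (metis zero_neq_one)
    moreover have "Poly_Mapping.keys \<omega> \<subseteq> coords Q d"
      using coords[OF a] by (auto simp: \<omega> in_keys_iff lookup_root of_bool_def split: if_splits)
    moreover have "quiver_rep Q d (torus_elem Q d t) w =
        quiver_smult Q (\<Prod>p\<in>coords Q d. t p powi Poly_Mapping.lookup \<omega> p) w"
      if t: "\<forall>p\<in>coords Q d. t p \<noteq> 0" for t
    proof
      fix b
      have prod: "(\<Prod>p\<in>coords Q d. t p powi Poly_Mapping.lookup \<omega> p)
          = t (head Q a, i) * inverse (t (tail Q a, j))"
        unfolding \<omega> using coords[OF a] t by (intro prod_powi_root fin) auto
      show "quiver_rep Q d (torus_elem Q d t) w b =
          quiver_smult Q (\<Prod>p\<in>coords Q d. t p powi Poly_Mapping.lookup \<omega> p) w b"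
      proof (cases "b \<in> arcs Q")
        case True
        then show ?thesis
          using quiver_rep_torus[OF wf_digraph_axioms True w] t prod
          by (auto simp: quiver_smult_def w_def intro!: eq_matI)
      next
        case False
        then show ?thesis by (simp add: quiver_rep_def quiver_smult_def)
      qed
    qed
    ultimately show "\<omega> \<in> weights Q d" using w by (auto simp: weights_def)
  qed
qed

lemma finite_coords: "fin_digraph Q \<Longrightarrow> finite (coords Q d)"
  by (simp add: coords_def fin_digraph.finite_verts)

lemma weights_are_roots:
  assumes "fin_digraph Q" "\<omega> \<in> weights Q d"
  obtains p q where "p \<in> coords Q d" "q \<in> coords Q d" "\<omega> = root_vec p q"
proof -
  interpret fin_digraph Q by (rule assms(1))
  obtain a i j where a: "a \<in> arcs Q" "i < d (head Q a)" "j < d (tail Q a)"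
    and "\<omega> = root_vec (head Q a, i) (tail Q a, j)"
    using assms(2) unfolding weights_eq_roots[OF assms(1)] by blast
  then show thesis by (intro that) (auto simp: coords_def)
qed

lemma finite_weights:
  assumes "fin_digraph Q"
  shows "finite (weights Q d)"
proof (rule finite_subset)
  show "weights Q d \<subseteq> (\<lambda>(p, q). root_vec p q) ` (coords Q d \<times> coords Q d)"
    by (auto elim!: weights_are_roots[OF assms])
  show "finite ((\<lambda>(p, q). root_vec p q) ` (coords Q d \<times> coords Q d))"
    using finite_coords[OF assms] by simp
qed

lemma totally_unimodular_weights:
  assumes "fin_digraph Q"
  shows "totally_unimodular (weights Q d) (coords Q d) Poly_Mapping.lookup"
  unfolding totally_unimodular_def
proof (intro allI impI)
  fix m and r :: "nat \<Rightarrow> 'a \<times> nat \<Rightarrow>\<^sub>0 int" and c :: "nat \<Rightarrow> 'a \<times> nat"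
  assume rc: "inj_on r {..<m} \<and> r ` {..<m} \<subseteq> weights Q d \<and> inj_on c {..<m} \<and> c ` {..<m} \<subseteq> coords Q d"
  have "\<exists>p q. r i = root_vec p q" if "i < m" for i
  proof -
    have "r i \<in> weights Q d" using rc that by auto
    then show ?thesis by (metis weights_are_roots[OF assms])
  qed
  then obtain p q where pq: "\<And>i. i < m \<Longrightarrow> r i = root_vec (p i) (q i)" by metis
  have "Matrix.mat m m (\<lambda>(i, j). Poly_Mapping.lookup (r i) (c j))
      = Matrix.mat m m (\<lambda>(i, j). of_bool (c j = p i) - of_bool (c j = q i))"
    by (intro eq_matI) (auto simp: pq lookup_root)
  then show "Determinant.det (Matrix.mat m m (\<lambda>(i, j). Poly_Mapping.lookup (r i) (c j))) \<in> {-1, 0, 1}"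
    using det_signed_incidence[of c m p q] rc by simp
qed

section \<open>Margin and norm for the general linear group\<close>

lemma lookup_map_of_int:
  "Poly_Mapping.lookup (Poly_Mapping.map real_of_int \<omega>) c = real_of_int (Poly_Mapping.lookup \<omega> c)"
  by (simp add: Poly_Mapping.map.rep_eq when_def)

lemma pairing_root_vec:
  assumes "finite I" "p \<in> I" "q \<in> I"
  shows "pairing I \<phi> (Poly_Mapping.map real_of_int (root_vec p q)) = \<phi> p - \<phi> q"
proof -
  have "pairing I \<phi> (Poly_Mapping.map real_of_int (root_vec p q))
      = (\<Sum>c\<in>I. (if c = p then \<phi> c else 0) - (if c = q then \<phi> c else 0))"
    unfolding pairing_def by (intro sum.cong) (auto simp: lookup_map_of_int lookup_root)
  then show ?thesis using assms by (simp add: sum_subtractf)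
qed

lemma keys_real_weights:
  "v \<in> real_weights Q d \<Longrightarrow> Poly_Mapping.keys v \<subseteq> coords Q d"
  by (auto simp: real_weights_def weights_def in_keys_iff lookup_map_of_int)

lemma powr_three_halves:
  assumes "0 \<le> x"
  shows "x powr (-3/2) = 1 / (sqrt x * x)"
proof -
  have "x powr (3/2) = sqrt x * x"
    using powr_add[of x "1/2" 1] assms by (simp add: powr_half_sqrt)
  then show ?thesis using powr_minus_divide[of x "3/2"] by simp
qed

lemma weight_margin_real_weights:
  assumes "fin_digraph Q" "0 < card (coords Q d)"
  shows "ereal (real (card (coords Q d)) powr (-3/2)) \<le> weight_margin (real_weights Q d)"
proof -
  let ?I = "coords Q d" and ?n = "real (card (coords Q d))"
  let ?real = "Poly_Mapping.map real_of_int :: ('a \<times> nat \<Rightarrow>\<^sub>0 int) \<Rightarrow> _"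
  have finI: "finite ?I" by (rule finite_coords[OF assms(1)])
  have "ereal (1 / (sqrt ?n * ?n)) \<le> weight_margin (real_weights Q d)"
  proof (rule weight_margin_ge[OF finI keys_real_weights])
    fix \<Gamma> assume \<Gamma>: "\<Gamma> \<subseteq> real_weights Q d" "0 \<notin> convex hull \<Gamma>"
    have "finite \<Gamma>"
      using \<Gamma>(1) finite_weights[OF assms(1)] by (auto simp: real_weights_def intro: finite_subset)
    then obtain \<phi> where \<phi>: "\<forall>v\<in>\<Gamma>. 1 \<le> pairing ?I \<phi> v"
      using separating_functional[of \<Gamma> ?I] \<Gamma> finI keys_real_weights by blast
    define E where "E = {(p, q) \<in> ?I \<times> ?I. ?real (root_vec p q) \<in> \<Gamma>}"
    have "1 \<le> \<phi> p - \<phi> q" if "(p, q) \<in> E" for p q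
      using that \<phi> pairing_root_vec[OF finI, of p q \<phi>] by (auto simp: E_def)
    moreover have "E \<subseteq> ?I \<times> ?I" by (auto simp: E_def)
    ultimately obtain h :: "'a \<times> nat \<Rightarrow> real" where h: "\<And>p q. (p, q) \<in> E \<Longrightarrow> 1 \<le> h p - h q"
      and bound: "\<And>p. \<bar>h p\<bar> \<le> ?n"
      using rank_potential[OF finI, of E \<phi>] by metis
    have "1 \<le> pairing ?I h v" if v: "v \<in> \<Gamma>" for v
    proof -
      obtain \<omega> where "\<omega> \<in> weights Q d" "v = ?real \<omega>"
        using v \<Gamma>(1) by (auto simp: real_weights_def)
      moreover obtain p q where pq: "p \<in> ?I" "q \<in> ?I" "\<omega> = root_vec p q"
        using weights_are_roots[OF assms(1) \<open>\<omega> \<in> _\<close>] by blast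
      ultimately show ?thesis using v h[of p q] pairing_root_vec[OF finI pq(1,2), of h] by (auto simp: E_def)
    qed
    moreover have "L2_set h ?I \<le> sqrt ?n * ?n" using bound by (intro L2_set_le_of_bounded) auto
    ultimately show "\<exists>\<phi>. (\<forall>v\<in>\<Gamma>. 1 \<le> pairing ?I \<phi> v) \<and> L2_set \<phi> ?I \<le> sqrt ?n * ?n" by blast
  next
    show "0 < sqrt ?n * ?n"
      using assms(2) by (metis mult_pos_pos of_nat_0_less_iff real_sqrt_gt_zero)
  qed
  then show ?thesis unfolding powr_three_halves[OF of_nat_0_le_iff] .
qed

lemma norm2_root_vec:
  "norm2 (Poly_Mapping.map real_of_int (root_vec p q)) = (if p = q then 0 else sqrt 2)"
proof -
  have "Poly_Mapping.keys (Poly_Mapping.map real_of_int (root_vec p q)) \<subseteq> {p, q}"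
    by (auto simp: in_keys_iff lookup_map_of_int lookup_root split: if_splits)
  then have "norm2 (Poly_Mapping.map real_of_int (root_vec p q))
      = L2_set (Poly_Mapping.lookup (Poly_Mapping.map real_of_int (root_vec p q))) {p, q}"
    by (intro norm2_eq_L2_set) auto
  then show ?thesis by (auto simp: L2_set_def lookup_map_of_int lookup_root)
qed

lemma weight_norm_real_weights:
  assumes "fin_digraph Q"
  shows "weight_norm (real_weights Q d) =
    (if \<exists>p q. p \<noteq> q \<and> root_vec p q \<in> weights Q d then sqrt 2 else 0)"
proof -
  let ?N = "norm2 ` real_weights Q d"
  have fin: "finite ?N" using finite_weights[OF assms] by (simp add: real_weights_def)
  have N: "?N \<subseteq> {0, sqrt 2}"
  proof -
    have "norm2 (Poly_Mapping.map real_of_int \<omega>) \<in> {0, sqrt 2}" if "\<omega> \<in> weights Q d" for \<omega>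
      by (rule weights_are_roots[OF assms that]) (simp add: norm2_root_vec)
    then show ?thesis by (auto simp: real_weights_def)
  qed
  show ?thesis
  proof (cases "\<exists>p q. p \<noteq> q \<and> root_vec p q \<in> weights Q d")
    case True
    then obtain p q where "p \<noteq> q" "root_vec p q \<in> weights Q d" by blast
    then have "sqrt 2 \<in> ?N"
      by (force simp: real_weights_def image_iff norm2_root_vec)
    moreover have "y \<le> sqrt 2" if "y \<in> ?N" for y
    proof -
      have "y \<in> {0, sqrt 2}" using N that by blast
      then show ?thesis by auto
    qed
    ultimately have "Max ?N = sqrt 2" by (intro Max_eqI[OF fin])
    moreover have "real_weights Q d \<noteq> {}" using \<open>sqrt 2 \<in> ?N\<close> by blast
    ultimately show ?thesis using True by (auto simp: weight_norm_def)
  next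
    case False
    have "norm2 (Poly_Mapping.map real_of_int \<omega>) = 0" if "\<omega> \<in> weights Q d" for \<omega>
      by (rule weights_are_roots[OF assms that]) (use False that in \<open>auto simp: norm2_root_vec\<close>)
    then have "?N \<subseteq> {0}" by (auto simp: real_weights_def)
    then have "weight_norm (real_weights Q d) = 0"
      by (auto simp: weight_norm_def intro!: Max_eqI fin)
    then show ?thesis using False by simp
  qed
qed

text \<open>
  An arrow yields only the zero weight precisely when its matrix is \<open>1 \<times> 1\<close> with equal head and tail.
\<close>

lemma exists_nonzero_weight_iff:
  assumes "fin_digraph Q" "\<And>x. x \<in> verts Q \<Longrightarrow> 0 < d x"
  shows "(\<exists>p q. p \<noteq> q \<and> root_vec p q \<in> weights Q d) \<longleftrightarrow>
    \<not> (\<forall>a\<in>arcs Q. tail Q a = head Q a \<and> d (tail Q a) = 1)"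
proof -
  interpret fin_digraph Q by (rule assms(1))
  have root_eq: "p = p' \<and> q = q'" if "root_vec p q = root_vec p' q'" "p \<noteq> q" for p q p' q' :: "'a \<times> nat"
  proof -
    have "\<And>c. Poly_Mapping.lookup (root_vec p q) c = Poly_Mapping.lookup (root_vec p' q') c"
      using that(1) by simp
    from this[of p] this[of q] show ?thesis using that(2) by (auto simp: lookup_root of_bool_def split: if_splits)
  qed
  show ?thesis
  proof
    assume "\<exists>p q. p \<noteq> q \<and> root_vec p q \<in> weights Q d"
    then obtain p q a i j where "p \<noteq> q" and a: "a \<in> arcs Q" "i < d (head Q a)" "j < d (tail Q a)"
      and "root_vec p q = root_vec (head Q a, i) (tail Q a, j)"
      unfolding weights_eq_roots[OF assms(1)] by blast
    then have "(head Q a, i) \<noteq> (tail Q a, j)" using root_eq by blast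
    with a show "\<not> (\<forall>a\<in>arcs Q. tail Q a = head Q a \<and> d (tail Q a) = 1)" by fastforce
  next
    assume "\<not> (\<forall>a\<in>arcs Q. tail Q a = head Q a \<and> d (tail Q a) = 1)"
    then obtain a where a: "a \<in> arcs Q" and "tail Q a \<noteq> head Q a \<or> d (tail Q a) \<noteq> 1" by blast
    have pos: "0 < d (head Q a)" "0 < d (tail Q a)" using a assms(2) by auto
    obtain j where j: "j < d (tail Q a)" "(head Q a, 0) \<noteq> (tail Q a, j)"
    proof (cases "tail Q a = head Q a")
      case True
      then have "1 < d (tail Q a)" using \<open>tail Q a \<noteq> head Q a \<or> _\<close> pos by simp
      then show ?thesis by (intro that[of 1]) auto
    next
      case False
      then show ?thesis using pos by (intro that[of 0]) auto
    qed
    then have "root_vec (head Q a, 0) (tail Q a, j) \<in> weights Q d"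
      unfolding weights_eq_roots[OF assms(1)] using a pos by blast
    then show "\<exists>p q. p \<noteq> q \<and> root_vec p q \<in> weights Q d" using j(2) by blast
  qed
qed

section \<open>Margin for the special linear group\<close>

text \<open>
  \<open>v\<close> agrees, on the coordinates, with the orthogonal projection of \<open>\<omega>\<close> to the vectors that have zero
  sum at every vertex.
\<close>

definition SL_restriction ::
  "('v, 'a) pre_digraph \<Rightarrow> ('v \<Rightarrow> nat) \<Rightarrow> ('v \<times> nat \<Rightarrow>\<^sub>0 int) \<Rightarrow> ('v \<times> nat \<Rightarrow>\<^sub>0 real) \<Rightarrow> bool" where
  "SL_restriction Q d \<omega> v \<longleftrightarrow> (\<forall>x\<in>verts Q. \<forall>i<d x.
     Poly_Mapping.lookup v (x, i) = real_of_int (Poly_Mapping.lookup \<omega> (x, i))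
       - real_of_int (\<Sum>j<d x. Poly_Mapping.lookup \<omega> (x, j)) / real (d x))"

lemma SL_weights_alt:
  "SL_weights Q d = {v. Poly_Mapping.keys v \<subseteq> coords Q d \<and> (\<exists>\<omega>\<in>weights Q d. SL_restriction Q d \<omega> v)}"
  by (simp add: SL_weights_def SL_restriction_def)

lemma SL_restriction_unique:
  assumes "SL_restriction Q d \<omega> u" "SL_restriction Q d \<omega> v"
    and "Poly_Mapping.keys u \<subseteq> coords Q d" "Poly_Mapping.keys v \<subseteq> coords Q d"
  shows "u = v"
proof (rule poly_mapping_eqI)
  fix c
  show "Poly_Mapping.lookup u c = Poly_Mapping.lookup v c"
  proof (cases "c \<in> coords Q d")
    case True
    then show ?thesis using assms(1,2) by (auto simp: SL_restriction_def coords_def)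
  next
    case False
    then show ?thesis using assms(3,4) by (metis in_keys_iff subsetD)
  qed
qed

lemma finite_SL_weights:
  assumes "fin_digraph Q"
  shows "finite (SL_weights Q d)"
proof -
  have "\<forall>v\<in>SL_weights Q d. \<exists>\<omega>. \<omega> \<in> weights Q d \<and> SL_restriction Q d \<omega> v"
    by (auto simp: SL_weights_alt)
  then obtain lift where lift: "\<forall>v\<in>SL_weights Q d. lift v \<in> weights Q d \<and> SL_restriction Q d (lift v) v"
    by (rule bchoice[THEN exE])
  show ?thesis
  proof (rule inj_on_finite)
    show "inj_on lift (SL_weights Q d)"
    proof (rule inj_onI)
      fix u v assume uv: "u \<in> SL_weights Q d" "v \<in> SL_weights Q d" "lift u = lift v"
      show "u = v"
      proof (rule SL_restriction_unique)
        show "SL_restriction Q d (lift u) u" using lift uv(1) by blast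
        show "SL_restriction Q d (lift u) v" unfolding uv(3) using lift uv(2) by blast
      qed (use uv in \<open>simp_all add: SL_weights_def\<close>)
    qed
    show "lift ` SL_weights Q d \<subseteq> weights Q d" using lift by blast
    show "finite (weights Q d)" by (rule finite_weights[OF assms])
  qed
qed

lemma pairing_coords:
  assumes "fin_digraph Q"
  shows "pairing (coords Q d) \<phi> v = (\<Sum>x\<in>verts Q. \<Sum>i<d x. \<phi> (x, i) * Poly_Mapping.lookup v (x, i))"
proof -
  interpret fin_digraph Q by (rule assms)
  show ?thesis by (simp add: pairing_def coords_def sum.Sigma)
qed

text \<open>
  A functional with zero vertex sums does not see the vertex averages that the restriction
  subtracts; on restricted weights it takes the same values as on the weights themselves.
\<close>

lemma pairing_balanced_restriction:
  assumes "fin_digraph Q" "SL_restriction Q d \<omega> v"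
    and "\<And>x. x \<in> verts Q \<Longrightarrow> (\<Sum>i<d x. \<phi> (x, i)) = 0"
  shows "pairing (coords Q d) \<phi> v = pairing (coords Q d) \<phi> (Poly_Mapping.map real_of_int \<omega>)"
  unfolding pairing_coords[OF assms(1)]
proof (rule sum.cong[OF refl])
  fix x assume x: "x \<in> verts Q"
  define m where "m = real_of_int (\<Sum>j<d x. Poly_Mapping.lookup \<omega> (x, j)) / real (d x)"
  have "(\<Sum>i<d x. \<phi> (x, i) * Poly_Mapping.lookup v (x, i))
      = (\<Sum>i<d x. \<phi> (x, i) * real_of_int (Poly_Mapping.lookup \<omega> (x, i)) - \<phi> (x, i) * m)"
    using assms(2) x by (intro sum.cong) (auto simp: SL_restriction_def m_def right_diff_distrib)
  also have "\<dots> = (\<Sum>i<d x. \<phi> (x, i) * real_of_int (Poly_Mapping.lookup \<omega> (x, i)))"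
    using assms(3)[OF x] by (simp add: sum_subtractf flip: sum_distrib_right)
  finally show "(\<Sum>i<d x. \<phi> (x, i) * Poly_Mapping.lookup v (x, i))
      = (\<Sum>i<d x. \<phi> (x, i) * Poly_Mapping.lookup (Poly_Mapping.map real_of_int \<omega>) (x, i))"
    by (simp add: lookup_map_of_int)
qed

definition vertex_centred :: "('v \<Rightarrow> nat) \<Rightarrow> ('v \<times> nat \<Rightarrow> real) \<Rightarrow> 'v \<times> nat \<Rightarrow> real" where
  "vertex_centred d \<psi> = (\<lambda>(x, i). \<psi> (x, i) - (\<Sum>j<d x. \<psi> (x, j)) / real (d x))"

lemma sum_vertex_centred: "(\<Sum>i<d x. vertex_centred d \<psi> (x, i)) = 0"
  by (cases "d x = 0") (simp_all add: vertex_centred_def sum_subtractf)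

text \<open>
  A restricted weight has zero sum at every vertex, so the averages removed from the functional do not
  matter.  A separating functional can therefore be made balanced.
\<close>

lemma pairing_vertex_centred:
  assumes "fin_digraph Q" "SL_restriction Q d \<omega> v"
  shows "pairing (coords Q d) (vertex_centred d \<psi>) v = pairing (coords Q d) \<psi> v"
  unfolding pairing_coords[OF assms(1)]
proof (rule sum.cong[OF refl])
  fix x assume x: "x \<in> verts Q"
  have "(\<Sum>i<d x. Poly_Mapping.lookup v (x, i)) = (\<Sum>i<d x. real_of_int (Poly_Mapping.lookup \<omega> (x, i))
      - real_of_int (\<Sum>j<d x. Poly_Mapping.lookup \<omega> (x, j)) / real (d x))"
    using assms(2) x by (intro sum.cong) (auto simp: SL_restriction_def)
  then have zero: "(\<Sum>i<d x. Poly_Mapping.lookup v (x, i)) = 0"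
    by (cases "d x = 0") (simp_all add: sum_subtractf)
  define m where "m = (\<Sum>j<d x. \<psi> (x, j)) / real (d x)"
  have "(\<Sum>i<d x. vertex_centred d \<psi> (x, i) * Poly_Mapping.lookup v (x, i))
      = (\<Sum>i<d x. \<psi> (x, i) * Poly_Mapping.lookup v (x, i) - m * Poly_Mapping.lookup v (x, i))"
    by (simp add: vertex_centred_def m_def left_diff_distrib)
  then show "(\<Sum>i<d x. vertex_centred d \<psi> (x, i) * Poly_Mapping.lookup v (x, i))
      = (\<Sum>i<d x. \<psi> (x, i) * Poly_Mapping.lookup v (x, i))"
    using zero by (simp add: sum_subtractf flip: sum_distrib_left)
qed

lemma coords_fibre:
  assumes "x \<in> verts Q"
  shows "{c \<in> coords Q d. fst c = x} = Pair x ` {..<d x}"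
  using assms by (auto simp: coords_def)

text \<open>
  After centring, a separating functional is a balanced potential on the graph of all pairs \<open>(p, q)\<close> for
  which the restriction of \<open>e\<^sub>p - e\<^sub>q\<close> lies in \<open>\<Gamma>\<close>.  It can be replaced by one with entries at most
  \<open>P n\<^sup>k + n - 1\<close>, and this is at most \<open>P\<^sup>k (n + 1)\<^sup>k n\<close> since \<open>n\<^sup>k + 1 \<le> (n + 1)\<^sup>k\<close> for \<open>k \<ge> 1\<close>.
\<close>

lemma weight_margin_SL_weights:
  fixes Q :: "('v, 'a) pre_digraph"
  defines "k \<equiv> card (verts Q)"
  assumes Q: "fin_digraph Q" and pos: "\<And>x. x \<in> verts Q \<Longrightarrow> 0 < d x"
    and n: "n = (\<Sum>x\<in>verts Q. d x)" and P: "P = (\<Prod>x\<in>verts Q. d x)" and "0 < n"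
  shows "ereal (1 / (sqrt (real n) * (real P ^ k * real (n + 1) ^ k * real n)))
    \<le> weight_margin (SL_weights Q d)"
proof -
  interpret fin_digraph Q by (rule Q)
  let ?I = "coords Q d"
  let ?b = "real P ^ k * real (n + 1) ^ k * real n"
  have finI: "finite ?I" by (rule finite_coords[OF Q])
  have card_I: "card ?I = n" unfolding coords_def n by (subst card_SigmaI) auto
  have fst_I: "fst ` ?I = verts Q"
    using pos by (force simp: coords_def image_iff)
  have card_fibre: "card {c \<in> ?I. fst c = x} = d x" if "x \<in> verts Q" for x
    unfolding coords_fibre[OF that] by (simp add: card_image inj_on_def)
  have fibre_sum: "(\<Sum>c\<in>{c \<in> ?I. fst c = x}. \<phi> c) = (\<Sum>i<d x. \<phi> (x, i))" if "x \<in> verts Q"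
    for \<phi> :: "'v \<times> nat \<Rightarrow> real" and x
    unfolding coords_fibre[OF that] by (simp add: sum.reindex inj_on_def)
  have "0 < P" unfolding P using pos by (intro prod_pos)
  have "0 < k" using \<open>0 < n\<close> unfolding n k_def by (auto simp: card_gt_0_iff intro: gr0I)
  have numeric: "real (P * n ^ k) + (real n - 1) \<le> ?b"
  proof -
    have "P * 1 \<le> P * P ^ (k - 1)" using \<open>0 < P\<close> by (intro mult_le_mono) auto
    then have "P \<le> P ^ k" using \<open>0 < k\<close> by (simp flip: power_Suc)
    have "n ^ k < (n + 1) ^ k" using \<open>0 < k\<close> by (intro power_strict_mono) auto
    then have step: "n ^ k + 1 \<le> (n + 1) ^ k" by simp
    have "P * n ^ k + (n - 1) \<le> P * n ^ k * n + P * n"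
      using \<open>0 < n\<close> \<open>0 < P\<close> by (intro add_mono) (auto intro: le_trans[of _ n])
    also have "\<dots> = P * (n ^ k + 1) * n" by (simp add: algebra_simps)
    also have "\<dots> \<le> P ^ k * (n + 1) ^ k * n"
      using \<open>P \<le> P ^ k\<close> step by (intro mult_le_mono) auto
    finally have "real (P * n ^ k + (n - 1)) \<le> real (P ^ k * (n + 1) ^ k * n)" by (rule of_nat_mono)
    then show ?thesis using \<open>0 < n\<close> by (simp add: of_nat_diff)
  qed
  show ?thesis
  proof (rule weight_margin_ge[OF finI])
    show "0 < sqrt (real n) * ?b" using \<open>0 < n\<close> \<open>0 < P\<close> by simp
    show "Poly_Mapping.keys v \<subseteq> ?I" if "v \<in> SL_weights Q d" for v
      using that by (simp add: SL_weights_def)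
    fix \<Gamma> assume \<Gamma>: "\<Gamma> \<subseteq> SL_weights Q d" "0 \<notin> convex hull \<Gamma>"
    have "finite \<Gamma>" using \<Gamma>(1) finite_SL_weights[OF Q] by (rule finite_subset)
    moreover have "Poly_Mapping.keys v \<subseteq> ?I" if "v \<in> \<Gamma>" for v
      using that \<Gamma>(1) by (auto simp: SL_weights_def)
    ultimately obtain \<psi> where \<psi>: "\<forall>v\<in>\<Gamma>. 1 \<le> pairing ?I \<psi> v"
      using separating_functional[of \<Gamma> ?I] \<Gamma>(2) finI by blast
    define E where "E = {(p, q) \<in> ?I \<times> ?I. \<exists>v\<in>\<Gamma>. SL_restriction Q d (root_vec p q) v}"
    have E: "E \<subseteq> ?I \<times> ?I" by (auto simp: E_def)
    have zero_sums: "(\<Sum>i<d x. \<phi> (x, i)) = 0"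
      if "balanced_potential ?I fst E \<phi>" "x \<in> verts Q" for \<phi> x
      using that fibre_sum[of x \<phi>] by (simp add: balanced_potential_def)
    have "balanced_potential ?I fst E (vertex_centred d \<psi>)"
      unfolding balanced_potential_def
    proof (intro conjI ballI allI)
      fix e assume "e \<in> E"
      then obtain p q v where e: "e = (p, q)" "p \<in> ?I" "q \<in> ?I"
        and v: "v \<in> \<Gamma>" "SL_restriction Q d (root_vec p q) v" by (auto simp: E_def)
      have "1 \<le> pairing ?I (vertex_centred d \<psi>) v"
        using \<psi> v(1) by (simp add: pairing_vertex_centred[OF Q v(2)])
      also have "\<dots> = vertex_centred d \<psi> p - vertex_centred d \<psi> q"
        using e pairing_balanced_restriction[OF Q v(2), of "vertex_centred d \<psi>"]
        by (simp add: sum_vertex_centred pairing_root_vec[OF finI])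
      finally show "case e of (p, q) \<Rightarrow> vertex_centred d \<psi> p - vertex_centred d \<psi> q \<ge> 1"
        using e by simp
    next
      fix x
      show "(\<Sum>c\<in>{c \<in> ?I. fst c = x}. vertex_centred d \<psi> c) = 0"
      proof (cases "x \<in> verts Q")
        case True
        then show ?thesis by (simp only: fibre_sum sum_vertex_centred)
      next
        case False
        then have "{c \<in> ?I. fst c = x} = {}" by (auto simp: coords_def)
        then show ?thesis by (simp only: sum.empty)
      qed
    qed
    then obtain \<phi> where bal: "balanced_potential ?I fst E \<phi>"
      and bound: "\<And>c. c \<in> ?I \<Longrightarrow> \<bar>\<phi> c\<bar> \<le> real ((\<Prod>x\<in>fst ` ?I. card {c \<in> ?I. fst c = x})
        * card ?I ^ card (fst ` ?I)) + (real (card ?I) - 1)"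
      using bounded_balanced_potential[OF finI E] by blast
    have fibres: "(\<Prod>x\<in>verts Q. card {c \<in> ?I. fst c = x}) = P"
      unfolding P by (intro prod.cong card_fibre refl)
    have "\<bar>\<phi> c\<bar> \<le> ?b" if "c \<in> ?I" for c
      using order_trans[OF bound[OF that, unfolded fst_I card_I fibres, folded k_def] numeric] .
    then have "L2_set \<phi> ?I \<le> sqrt (real n) * ?b"
      using L2_set_le_of_bounded[of ?I \<phi> ?b] card_I by simp
    moreover have "1 \<le> pairing ?I \<phi> v" if v: "v \<in> \<Gamma>" for v
    proof -
      obtain \<omega> where \<omega>: "\<omega> \<in> weights Q d" "SL_restriction Q d \<omega> v"
        using v \<Gamma>(1) by (auto simp: SL_weights_alt)
      obtain p q where pq: "p \<in> ?I" "q \<in> ?I" "\<omega> = root_vec p q"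
        by (rule weights_are_roots[OF Q \<omega>(1)])
      then have "(p, q) \<in> E" using v \<omega>(2) by (auto simp: E_def)
      then have "1 \<le> \<phi> p - \<phi> q" using bal by (auto simp: balanced_potential_def)
      also have "\<dots> = pairing ?I \<phi> v"
        using pairing_balanced_restriction[OF Q \<omega>(2), of \<phi>] zero_sums[OF bal] pq
        by (simp add: pairing_root_vec[OF finI])
      finally show ?thesis .
    qed
    ultimately show "\<exists>\<phi>. (\<forall>v\<in>\<Gamma>. 1 \<le> pairing ?I \<phi> v) \<and> L2_set \<phi> ?I \<le> sqrt (real n) * ?b" by blast
  qed
qed

section \<open>The combined statement\<close>

theorem theorem6p21:
  fixes Q :: "('v, 'a) pre_digraph"
    and d :: "'v \<Rightarrow> nat"
    and k n P :: nat
  assumes "fin_digraph Q"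
    and "\<And>x. x \<in> verts Q \<Longrightarrow> 0 < d x"
    and "k = card (verts Q)"
    and "n = (\<Sum>x\<in>verts Q. d x)"
    and "P = (\<Prod>x\<in>verts Q. d x)"
  shows "totally_unimodular (weights Q d) (coords Q d) Poly_Mapping.lookup
    \<and> weight_margin (real_weights Q d) \<ge> ereal (real n powr (-3/2))
    \<and> weight_norm (real_weights Q d) \<le> sqrt 2
    \<and> (weight_norm (real_weights Q d) = sqrt 2 \<longleftrightarrow>
          \<not> (\<forall>a\<in>arcs Q. tail Q a = head Q a \<and> d (tail Q a) = 1))
    \<and> weight_margin (SL_weights Q d) \<ge>
          ereal (real P powi (- int k) * real (n + 1) powi (- int k) * real n powr (-3/2))"
proof -
  interpret fin_digraph Q by (rule assms(1))
  have card_I: "card (coords Q d) = n" unfolding coords_def assms(4) by (subst card_SigmaI) auto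
  have margins: "weight_margin (real_weights Q d) \<ge> ereal (real n powr (-3/2)) \<and>
    weight_margin (SL_weights Q d) \<ge>
      ereal (real P powi (- int k) * real (n + 1) powi (- int k) * real n powr (-3/2))"
  proof (cases "n = 0")
    case True
    then have "coords Q d = {}" using card_I finite_coords[OF assms(1), of d] by simp
    \<comment> \<open>without coordinates there are no weights, and the margin of the empty set is infinite\<close>
    then have "weights Q d = {}"
      by (auto elim: weights_are_roots[OF assms(1)])
    then have "real_weights Q d = {}" "SL_weights Q d = {}"
      by (auto simp: real_weights_def SL_weights_def)
    moreover have "weight_margin ({} :: ('v \<times> nat \<Rightarrow>\<^sub>0 real) set) = \<infinity>"
    proof -
      have "{\<Gamma> :: ('v \<times> nat \<Rightarrow>\<^sub>0 real) set. \<Gamma> \<noteq> {} \<and> \<Gamma> \<subseteq> {} \<and> 0 \<notin> convex hull \<Gamma>} = {}" by auto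
      then show ?thesis unfolding weight_margin_def by (simp only: image_empty Inf_empty top_ereal_def)
    qed
    ultimately show ?thesis by simp
  next
    case False
    have "real P powi (- int k) * real (n + 1) powi (- int k) * real n powr (-3/2)
        = 1 / (sqrt (real n) * (real P ^ k * real (n + 1) ^ k * real n))"
      unfolding powr_three_halves[OF of_nat_0_le_iff] by (simp add: power_int_minus field_simps)
    then show ?thesis
      using weight_margin_real_weights[OF assms(1), of d] card_I False
        weight_margin_SL_weights[OF assms(1,2,4,5)] assms(3) by simp
  qed
  have norm: "weight_norm (real_weights Q d) =
      (if \<not> (\<forall>a\<in>arcs Q. tail Q a = head Q a \<and> d (tail Q a) = 1) then sqrt 2 else 0)"
    unfolding weight_norm_real_weights[OF assms(1)]
    by (simp only: exists_nonzero_weight_iff[OF assms(1,2)])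
  show ?thesis
    using totally_unimodular_weights[OF assms(1)] margins by (auto simp: norm)
qed

end
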